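(* There exists at most one solution $\varphi\in C^{1,1}(\overline\Omega_-)$ to the problem $$\begin{aligned} &\mathrm{div}(\rho(|\nabla\varphi|^2)\nabla\varphi)=0,&&(x,y)\in\Omega_-,\\ &\varphi(g(y),y)=C_{\rm in},&&0<y<f_-(l_-),\\ &\frac{\partial\varphi}{\partial y}(x,0)=0,&&g(0)<x<0,\\ &\frac{\partial\varphi}{\partial y}(x,f_-(x))-f_-'(x)\frac{\partial\varphi}{\partial x}(x,f_-(x))=0,&&l_-<x<0,\\ &|\nabla\varphi(0,y)|=c_*,\quad\varphi(0,y)=0,&&0<y<f_-(0),\\ &|\nabla\varphi(x,y)|<c_*,&&(x,y)\in\Omega_-, \end{aligned}$$ where $C_{\rm in}\in\mathbb R$ is a free constant (not prescribed; it is part of the unknown).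
   Context: $\gamma>1$, $\rho(q^2)=\big(1-\frac{\gamma-1}2q^2\big)^{1/(\gamma-1)}$ for $0<q<(2/(\gamma-1))^{1/2}$, and $c_*=(2/(\gamma+1))^{1/2}$ is the critical (sonic) speed. Nozzle: $l_-<0$, $f_-\in C^1([l_-,0])$ is positive with $f_-'<0$ on $[l_-,0)$ and $f_-'(0)=0$ (upper wall $y=f_-(x)$ of the convergent part); the inlet is the curve $x=g(y)$, $0\le y\le f_-(l_-)$, with $g(f_-(l_-))=l_-$. $\Omega_-$ is the bounded domain in $\{x<0,\ y>0\}$ enclosed by the inlet $x=g(y)$, the $x$-axis ($g(0)\le x\le0$), the wall $y=f_-(x)$ ($l_-\le x\le0$) and the throat segment $\{0\}\times[0,f_-(0)]$. Here $g$ is a $C^1$ function. The fifth line means that the flow is sonic at the throat and its potential is normalized to zero there. $\varphi$ is the velocity potential.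
   Formalization: The printed problem is unchanged under (φ, C_in) → (−φ, −C_in), so uniqueness is stated for solutions whose velocity at the throat points in the +x direction, and in general only up to this simultaneous change of sign. *)

theory Defs
  imports "HOL-Analysis.Analysis"
begin

text \<open>
  Points of the plane are pairs \<open>(x, y) :: real \<times> real\<close>, with the Euclidean norm and inner product
  of the product type.
\<close>

subsection \<open>Constitutive law\<close>

definition rho :: "real \<Rightarrow> real \<Rightarrow> real" where
  "rho \<gamma> s = (1 - (\<gamma> - 1) / 2 * s) powr (1 / (\<gamma> - 1))"

definition c_star :: "real \<Rightarrow> real" where
  "c_star \<gamma> = sqrt (2 / (\<gamma> + 1))"


subsection \<open>Nozzle\<close>

text \<open>The derivative at the endpoints is the one-sided one.\<close>

definition C1_on_interval :: "real \<Rightarrow> real \<Rightarrow> (real \<Rightarrow> real) \<Rightarrow> (real \<Rightarrow> real) \<Rightarrow> bool" where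
  "C1_on_interval a b f f' \<longleftrightarrow>
     (\<forall>x\<in>{a..b}. (f has_real_derivative f' x) (at x within {a..b})) \<and> continuous_on {a..b} f'"

definition convergent_wall :: "real \<Rightarrow> (real \<Rightarrow> real) \<Rightarrow> (real \<Rightarrow> real) \<Rightarrow> bool" where
  "convergent_wall l f f' \<longleftrightarrow>
     l < 0 \<and> C1_on_interval l 0 f f' \<and> (\<forall>x\<in>{l..0}. 0 < f x) \<and>
     (\<forall>x\<in>{l..<0}. f' x < 0) \<and> f' 0 = 0"

text \<open>
  The last two conditions say that the inlet lies in the half plane \<open>x < 0\<close> and meets the
  wall only in its endpoint \<open>(l, f l)\<close>, on the correct side of it; without them the four curves
  do not form a simple closed curve and there is no domain enclosed by them.
\<close>

definition inlet_curve :: "real \<Rightarrow> (real \<Rightarrow> real) \<Rightarrow> (real \<Rightarrow> real) \<Rightarrow> bool" where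
  "inlet_curve l f g \<longleftrightarrow>
     (\<exists>g'. C1_on_interval 0 (f l) g g') \<and> g (f l) = l \<and>
     (\<forall>y\<in>{0..f l}. g y < 0) \<and>
     (\<forall>y\<in>{0..<f l}. l \<le> g y \<longrightarrow> y < f (g y))"

definition nozzle_boundary :: "real \<Rightarrow> (real \<Rightarrow> real) \<Rightarrow> (real \<Rightarrow> real) \<Rightarrow> (real \<times> real) set" where
  "nozzle_boundary l f g =
     (\<lambda>y. (g y, y)) ` {0..f l} \<union> (\<lambda>x. (x, 0)) ` {g 0..0} \<union>
     (\<lambda>x. (x, f x)) ` {l..0} \<union> (\<lambda>y. (0, y)) ` {0..f 0}"

definition nozzle_domain :: "real \<Rightarrow> (real \<Rightarrow> real) \<Rightarrow> (real \<Rightarrow> real) \<Rightarrow> (real \<times> real) set" where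
  "nozzle_domain l f g = inside (nozzle_boundary l f g)"

lemma convergent_wall_strict_antimono:
  assumes "convergent_wall l f f'" "l \<le> a" "a < b" "b \<le> 0"
  shows "f b < f a"
proof (rule DERIV_neg_imp_decreasing_open[OF assms(3)])
  have D: "\<forall>x\<in>{l..0}. (f has_real_derivative f' x) (at x within {l..0})"
    using assms(1) by (auto simp: convergent_wall_def C1_on_interval_def)
  show "continuous_on {a..b} f"
    using D assms(2,4) by (intro continuous_on_subset[of "{l..0}" f "{a..b}"] DERIV_continuous_on) auto
  fix x assume x: "a < x" "x < b"
  then have "(f has_real_derivative f' x) (at x)"
    using D assms(2,4) at_within_Icc_at[of l x 0] by (metis atLeastAtMost_iff less_le_trans le_less_trans less_imp_le)
  then show "\<exists>y. (f has_real_derivative y) (at x) \<and> y < 0"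
    using x assms by (intro exI[of _ "f' x"]) (auto simp: convergent_wall_def)
qed

lemma ray_not_inside:
  fixes z d :: "'a :: real_normed_vector"
  assumes "d \<noteq> 0" "\<And>t. 0 \<le> t \<Longrightarrow> z + t *\<^sub>R d \<notin> S"
  shows "z \<notin> inside S"
proof
  let ?R = "(\<lambda>t. z + t *\<^sub>R d) ` {0..}"
  assume "z \<in> inside S"
  then have b: "bounded (connected_component_set (- S) z)" by (simp add: inside_def)
  have "connected ?R"
    by (intro connected_continuous_image continuous_intros) (rule is_interval_connected, auto simp: is_interval_ci)
  moreover have "?R \<subseteq> - S" using assms(2) by auto
  moreover have "z \<in> ?R" by (rule image_eqI[of _ _ 0]) auto
  ultimately have "?R \<subseteq> connected_component_set (- S) z"
    by (intro connected_component_maximal)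
  then have "bounded ?R" using b bounded_subset by blast
  then obtain B where B: "\<And>t. 0 \<le> t \<Longrightarrow> norm (z + t *\<^sub>R d) \<le> B"
    unfolding bounded_iff by auto
  define t where "t = (\<bar>B\<bar> + norm z + 1) / norm d"
  have "0 \<le> t" by (simp add: t_def)
  moreover have "norm (t *\<^sub>R d) = \<bar>B\<bar> + norm z + 1"
    using assms(1) by (simp add: t_def abs_of_nonneg)
  moreover have "norm (t *\<^sub>R d) \<le> norm (z + t *\<^sub>R d) + norm z"
    by (metis add_diff_cancel_left' norm_triangle_ineq4)
  ultimately show False using B[of t] by linarith
qed

lemma nozzle_domain_eq:
  assumes w: "convergent_wall l f f'" and i: "inlet_curve l f g"
  shows "nozzle_domain l f g =
           {(x, y). x < 0 \<and> 0 < y \<and> y < f l \<and> g y < x \<and> (l \<le> x \<longrightarrow> y < f x)}"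
proof -
  define F where "F x = f (max l (min 0 x))" for x
  define G where "G y = g (max 0 (min (f l) y))" for y
  have l: "l < 0" and g0: "\<And>y. y \<in> {0..f l} \<Longrightarrow> g y < 0" and gl: "g (f l) = l"
    and nc: "\<And>y. y \<in> {0..<f l} \<Longrightarrow> l \<le> g y \<Longrightarrow> y < f (g y)"
    and fp: "\<And>x. x \<in> {l..0} \<Longrightarrow> 0 < f x"
    using w i by (auto simp: convergent_wall_def inlet_curve_def)
  have C1_cont: "continuous_on {a..b} h" if "C1_on_interval a b h h'" for a b h h'
    using that by (auto simp: C1_on_interval_def intro!: DERIV_continuous_on)
  have fcont: "continuous_on {l..0} f"
    using w C1_cont[of l 0 f f'] by (simp add: convergent_wall_def)
  have gcont: "continuous_on {0..f l} g"
    using i C1_cont[of 0 "f l" g] by (auto simp: inlet_curve_def)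
  have fl: "0 < f l" using fp l by auto
  have Fcont: "continuous_on UNIV F"
    unfolding F_def using l
    by (intro continuous_on_compose2[OF fcont] continuous_intros) auto
  have Gcont: "continuous_on UNIV G"
    unfolding G_def using fl
    by (intro continuous_on_compose2[OF gcont] continuous_intros) auto
  have mono: "f b \<le> f a" if "l \<le> a" "a \<le> b" "b \<le> 0" for a b
    using convergent_wall_strict_antimono[OF w, of a b] that by (cases "a = b") auto
  have Ffl: "F x \<le> f l" for x unfolding F_def using l by (intro mono) auto
  have Fp: "0 < F x" for x unfolding F_def using l by (intro fp) auto
  define U where "U = {z :: real \<times> real. fst z < 0 \<and> 0 < snd z \<and> G (snd z) < fst z \<and> snd z < F (fst z)}"
  define W where "W = {z :: real \<times> real. fst z \<le> 0 \<and> 0 \<le> snd z \<and> G (snd z) \<le> fst z \<and> snd z \<le> F (fst z)}"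
  define S where "S = nozzle_boundary l f g"
  note ci = continuous_on_compose2[OF Fcont] continuous_on_compose2[OF Gcont]
  have oU: "open U" unfolding U_def
    by (intro open_Collect_conj open_Collect_less ci continuous_intros) auto
  have cW: "closed W" unfolding W_def
    by (intro closed_Collect_conj closed_Collect_le ci continuous_intros) auto
  have WUS: "W - U \<subseteq> S"
  proof
    fix z assume z: "z \<in> W - U"
    obtain x y where [simp]: "z = (x, y)" by (cases z)
    have W: "x \<le> 0" "0 \<le> y" "G y \<le> x" "y \<le> F x" using z by (auto simp: W_def)
    have yl: "y \<le> f l" using W(4) Ffl[of x] by linarith
    have Gy: "G y = g y" using W yl by (simp add: G_def)
    consider "x = 0" | "y = 0" | "G y = x" | "y = F x" using z by (auto simp: W_def U_def)
    then show "z \<in> S"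
    proof cases
      case 1 then show ?thesis using W l by (auto simp: S_def nozzle_boundary_def F_def)
    next
      case 2 then show ?thesis using W Gy by (auto simp: S_def nozzle_boundary_def)
    next
      case 3 then show ?thesis using W Gy yl by (auto simp: S_def nozzle_boundary_def)
    next
      case 4
      have "l \<le> x"
      proof (rule ccontr)
        assume "\<not> l \<le> x"
        then have "y = f l" using 4 l by (simp add: F_def)
        then show False using W(3) Gy gl \<open>\<not> l \<le> x\<close> by simp
      qed
      then show ?thesis using W 4 by (auto simp: S_def nozzle_boundary_def F_def)
    qed
  qed
  have SW: "S \<subseteq> W"
  proof
    fix z assume "z \<in> S"
    then consider y where "z = (g y, y)" "y \<in> {0..f l}" | x where "z = (x, 0)" "x \<in> {g 0..0}"
      | x where "z = (x, f x)" "x \<in> {l..0}" | y where "z = (0, y)" "y \<in> {0..f 0}"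
      by (auto simp: S_def nozzle_boundary_def)
    then show "z \<in> W"
    proof cases
      case 1
      have "y \<le> F (g y)"
      proof (cases "y = f l \<or> g y < l")
        case True
        then show ?thesis using 1 gl l by (auto simp: F_def)
      next
        case False
        then show ?thesis using 1 nc[of y] g0[of y] by (simp add: F_def)
      qed
      then show ?thesis using 1 g0[of y] by (auto simp: W_def G_def)
    next
      case 2
      then show ?thesis using fl Fp[of x] by (auto simp: W_def G_def less_imp_le)
    next
      case 3
      have fx: "0 \<le> f x" "f x \<le> f l" using 3 fp[of x] mono[of l x] by auto
      have "g (f x) \<le> x"
      proof (rule ccontr)
        assume a: "\<not> g (f x) \<le> x"
        then have "x \<noteq> l" using gl by auto
        then have "f x < f l" using convergent_wall_strict_antimono[OF w, of l x] 3 by auto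
        then have "f x < f (g (f x))" using nc[of "f x"] fx a 3 by auto
        moreover have "f (g (f x)) \<le> f x" using a 3 g0[of "f x"] fx by (intro mono) auto
        ultimately show False by simp
      qed
      then show ?thesis using 3 fx by (auto simp: W_def G_def F_def)
    next
      case 4
      have "y \<le> f l" using 4 mono[of l 0] l by auto
      then show ?thesis using 4 l g0[of y] by (auto simp: W_def G_def F_def)
    qed
  qed
  have US: "U \<inter> S = {}"
  proof -
    have "z \<notin> S" if "z \<in> U" for z
    proof
      assume "z \<in> S"
      then consider y where "z = (g y, y)" "y \<in> {0..f l}" | x where "z = (x, 0)"
        | x where "z = (x, f x)" "x \<in> {l..0}" | y where "z = (0, y)"
        by (auto simp: S_def nozzle_boundary_def)
      then show False using that by cases (auto simp: U_def F_def G_def)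
    qed
    then show ?thesis by auto
  qed
  have "bounded (g ` {0..f l})"
    by (intro compact_imp_bounded compact_continuous_image gcont) auto
  then obtain B where B: "\<And>y. y \<in> {0..f l} \<Longrightarrow> \<bar>g y\<bar> \<le> B"
    unfolding bounded_iff by (metis imageI real_norm_def)
  have bU: "bounded U"
  proof (rule bounded_subset[of "{-B..0} \<times> {0..f l}"])
    show "bounded ({-B..0} \<times> {0..f l})" by (intro bounded_Times) auto
    show "U \<subseteq> {-B..0} \<times> {0..f l}"
    proof
      fix z assume z: "z \<in> U"
      have "\<bar>G (snd z)\<bar> \<le> B" unfolding G_def using fl by (intro B) auto
      then show "z \<in> {-B..0} \<times> {0..f l}" using z Ffl[of "fst z"] by (cases z) (auto simp: U_def)
    qed
  qed
  have "closure U \<subseteq> W"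
    by (rule closure_minimal[OF _ cW]) (auto simp: U_def W_def)
  then have fr: "frontier U \<subseteq> S" using WUS oU by (auto simp: frontier_def interior_open)
  have "inside S = U"
  proof (intro equalityI subsetI)
    fix z assume z: "z \<in> U"
    let ?C = "connected_component_set (- S) z"
    have "z \<in> - S" using z US by auto
    then have "z \<in> ?C" by (simp add: connected_component_refl_eq)
    moreover have "?C \<subseteq> - S" by (rule connected_component_subset)
    ultimately have "?C \<subseteq> U"
      using connected_Int_frontier[of ?C U] z fr by blast
    then show "z \<in> inside S" using bU bounded_subset \<open>z \<in> - S\<close> by (auto simp: inside_def)
  next
    fix z assume z: "z \<in> inside S"
    show "z \<in> U"
    proof (rule ccontr)
      assume "z \<notin> U"
      moreover have "z \<notin> S" using z by (simp add: inside_def)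
      ultimately have "z \<notin> W" using WUS by auto
      then consider "0 < fst z" | "snd z < 0" | "fst z < G (snd z)" | "F (fst z) < snd z"
        by (auto simp: W_def not_le)
      then have "\<exists>d. d \<noteq> 0 \<and> (\<forall>t\<ge>0. z + t *\<^sub>R d \<notin> W)"
      proof cases
        case 1 then show ?thesis by (intro exI[of _ "(1, 0)"]) (auto simp: W_def zero_prod_def)
      next
        case 2 then show ?thesis by (intro exI[of _ "(0, -1)"]) (auto simp: W_def zero_prod_def)
      next
        case 3 then show ?thesis by (intro exI[of _ "(-1, 0)"]) (auto simp: W_def zero_prod_def)
      next
        case 4 then show ?thesis by (intro exI[of _ "(0, 1)"]) (auto simp: W_def zero_prod_def)
      qed
      then show False using ray_not_inside[of _ z S] z SW by blast
    qed
  qed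
  also have "U = {(x, y). x < 0 \<and> 0 < y \<and> y < f l \<and> g y < x \<and> (l \<le> x \<longrightarrow> y < f x)}"
  proof -
    have "(x < 0 \<and> 0 < y \<and> G y < x \<and> y < F x) \<longleftrightarrow>
          (x < 0 \<and> 0 < y \<and> y < f l \<and> g y < x \<and> (l \<le> x \<longrightarrow> y < f x))" for x y
      using Ffl[of x] by (auto simp: F_def G_def)
    then show ?thesis by (auto simp: U_def)
  qed
  finally show ?thesis by (simp add: nozzle_domain_def S_def)
qed


subsection \<open>The problem for the potential\<close>

text \<open>
  \<open>\<phi> \<in> C\<^sup>1\<^sup>,\<^sup>1(closure \<Omega>)\<close>: the classical gradient in \<open>\<Omega>\<close> has the Lipschitz extension \<open>v\<close> to the
  closure. The values of \<open>v\<close> on the closure are determined by \<open>\<phi>\<close>, and on the boundary they are what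
  \<open>\<nabla>\<phi>\<close> means.
\<close>

definition C11_closure :: "(real \<times> real) set \<Rightarrow> (real \<times> real \<Rightarrow> real) \<Rightarrow> (real \<times> real \<Rightarrow> real \<times> real) \<Rightarrow> bool" where
  "C11_closure \<Omega> \<phi> v \<longleftrightarrow>
     continuous_on (closure \<Omega>) \<phi> \<and> (\<forall>z\<in>\<Omega>. GDERIV \<phi> z :> v z) \<and>
     (\<exists>L. L-lipschitz_on (closure \<Omega>) v)"

definition test_function :: "(real \<times> real) set \<Rightarrow> (real \<times> real \<Rightarrow> real) \<Rightarrow> (real \<times> real \<Rightarrow> real \<times> real) \<Rightarrow> bool" where
  "test_function \<Omega> \<eta> \<eta>' \<longleftrightarrow>
     (\<forall>z. GDERIV \<eta> z :> \<eta>' z) \<and> continuous_on UNIV \<eta>' \<and>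
     (\<exists>K. compact K \<and> K \<subseteq> \<Omega> \<and> (\<forall>z. z \<notin> K \<longrightarrow> \<eta> z = 0))"

text \<open>
  \<open>div q = 0\<close> in the weak sense, tested with \<open>C\<^sup>1\<close> functions of compact support in \<open>\<Omega>\<close>. For \<open>\<phi>\<close> of
  class \<open>C\<^sup>1\<^sup>,\<^sup>1\<close> the mass flux \<open>q\<close> is only Lipschitz, so a pointwise divergence exists only almost
  everywhere.
\<close>

definition weakly_div_free :: "(real \<times> real) set \<Rightarrow> (real \<times> real \<Rightarrow> real \<times> real) \<Rightarrow> bool" where
  "weakly_div_free \<Omega> q \<longleftrightarrow>
     (\<forall>\<eta> \<eta>'. test_function \<Omega> \<eta> \<eta>' \<longrightarrow> (LINT z:\<Omega>|lborel. q z \<bullet> \<eta>' z) = 0)"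

text \<open>
  \<open>\<phi>\<close> is the potential, \<open>v\<close> its gradient on the closure of the domain, \<open>C\<close> the free inlet constant.
\<close>

definition subsonic_sonic_solution ::
  "real \<Rightarrow> real \<Rightarrow> (real \<Rightarrow> real) \<Rightarrow> (real \<Rightarrow> real) \<Rightarrow> (real \<Rightarrow> real) \<Rightarrow>
   (real \<times> real \<Rightarrow> real) \<Rightarrow> (real \<times> real \<Rightarrow> real \<times> real) \<Rightarrow> real \<Rightarrow> bool" where
  "subsonic_sonic_solution \<gamma> l f f' g \<phi> v C \<longleftrightarrow>
     C11_closure (nozzle_domain l f g) \<phi> v \<and>
     weakly_div_free (nozzle_domain l f g) (\<lambda>z. rho \<gamma> ((norm (v z))\<^sup>2) *\<^sub>R v z) \<and>
     (\<forall>y\<in>{0<..<f l}. \<phi> (g y, y) = C) \<and>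
     (\<forall>x\<in>{g 0<..<0}. snd (v (x, 0)) = 0) \<and>
     (\<forall>x\<in>{l<..<0}. snd (v (x, f x)) - f' x * fst (v (x, f x)) = 0) \<and>
     (\<forall>y\<in>{0<..<f 0}. norm (v (0, y)) = c_star \<gamma> \<and> \<phi> (0, y) = 0) \<and>
     (\<forall>z\<in>nozzle_domain l f g. norm (v z) < c_star \<gamma>)"

text \<open>
  All conditions are invariant under reversal of the flow, so they determine a solution only once
  the direction of the flow is fixed: from the inlet into the nozzle and out through the throat.
\<close>

lemma subsonic_sonic_solution_reverse:
  assumes "subsonic_sonic_solution \<gamma> l f f' g \<phi> v C"
  shows "subsonic_sonic_solution \<gamma> l f f' g (\<lambda>z. - \<phi> z) (\<lambda>z. - v z) (- C)"
proof -
  have "weakly_div_free \<Omega> (\<lambda>z. - q z)" if "weakly_div_free \<Omega> q" for \<Omega> q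
    using that unfolding weakly_div_free_def set_lebesgue_integral_def by simp
  moreover have "C11_closure \<Omega> (\<lambda>z. - \<phi> z) (\<lambda>z. - v z)" if "C11_closure \<Omega> \<phi> v" for \<Omega>
    using that unfolding C11_closure_def
    by (auto intro!: continuous_intros GDERIV_minus simp: lipschitz_on_def dist_minus)
  ultimately show ?thesis
    using assms unfolding subsonic_sonic_solution_def by (force simp: algebra_simps)
qed

definition exits_through_throat :: "(real \<Rightarrow> real) \<Rightarrow> (real \<times> real \<Rightarrow> real \<times> real) \<Rightarrow> bool" where
  "exits_through_throat f v \<longleftrightarrow> (\<forall>y\<in>{0<..<f 0}. 0 < fst (v (0, y)))"

end

theory Submission
  imports Defs
begin

text \<open>
  The proof is an energy argument. The sonic condition together with \<open>\<phi> = 0\<close> on the throat leaves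
  only \<open>v = (\<plusminus>c\<^sub>*, 0)\<close> there, because the derivative of \<open>\<phi>\<close> along the throat vanishes
  (\<open>throat_tangential\<close>), and by continuity the sign is the same along the whole throat
  (\<open>throat_velocity\<close>). Up to a reversal of one of the two flows the velocities of two solutions
  therefore agree on the throat, so that their mass fluxes \<open>q\<^sub>1\<close>, \<open>q\<^sub>2\<close> agree there too, and not only
  their potentials.

  Put \<open>Q = q\<^sub>1 - q\<^sub>2\<close> and \<open>\<psi> = (\<phi>\<^sub>1 - \<phi>\<^sub>2) - (C\<^sub>1 - C\<^sub>2)\<close>. Then \<open>div Q = 0\<close>, and the boundary
  integral in
  \<open>\<integral> Q \<bullet> \<nabla>\<psi> = \<integral> \<psi> Q \<bullet> n\<close>
  vanishes: \<open>\<psi>\<close> is zero on the inlet, \<open>Q\<close> is zero on the throat, and \<open>Q \<bullet> n\<close> is zero on the axis and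
  on the wall. In the subsonic range the mass flux is a strictly monotone function of the velocity
  (\<open>mass_flux_monotone\<close>), so
  \<open>Q \<bullet> \<nabla>\<psi> \<ge> 0\<close> with equality only where \<open>v\<^sub>1 = v\<^sub>2\<close>. Hence \<open>\<psi>\<close> is constant; it is zero on the inlet,
  and its value on the throat is \<open>C\<^sub>2 - C\<^sub>1\<close>.

  The integration by parts is carried out inside the weak form of \<open>div Q = 0\<close>, tested with truncations
  of \<open>\<psi>\<close>. Near the inlet a truncation of the values of \<open>\<psi>\<close> makes the test function
  vanish. Near the rest of the boundary one multiplies by a cutoff that depends on the single weight
  \<open>-x * y * (F x - y)\<close>, where \<open>F\<close> extends the wall function. Because \<open>Q\<close> is
  Lipschitz and has the boundary values above, \<open>\<bar>Q \<bullet> \<nabla>weight\<bar>\<close> is at most a multiple of the weight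
  itself (\<open>weight_flux_bound\<close>), and this is exactly what lets the gradient of the cutoff disappear in
  the limit (\<open>weakly_div_free_integral_gradient\<close>).
\<close>

section \<open>The mass flux of a subsonic velocity\<close>

definition mass_flux :: "real \<Rightarrow> 'a::real_inner \<Rightarrow> 'a" where
  "mass_flux \<gamma> a = rho \<gamma> ((norm a)\<^sup>2) *\<^sub>R a"

lemma c_star_pos: "\<gamma> > 1 \<Longrightarrow> 0 < c_star \<gamma>"
  by (simp add: c_star_def)

lemma c_star_sq: "\<gamma> > 1 \<Longrightarrow> (c_star \<gamma>)\<^sup>2 = 2 / (\<gamma> + 1)"
  by (simp add: c_star_def)

lemma rho_base_pos:
  assumes "\<gamma> > 1" "s \<le> (c_star \<gamma>)\<^sup>2"
  shows "0 < 1 - (\<gamma> - 1) / 2 * s"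
proof -
  have "(\<gamma> - 1) / 2 * s \<le> (\<gamma> - 1) / 2 * (2 / (\<gamma> + 1))"
    using assms by (intro mult_left_mono) (auto simp: c_star_sq)
  also have "\<dots> < 1" using assms by (simp add: field_simps)
  finally show ?thesis by simp
qed

lemma rho_pos: "\<gamma> > 1 \<Longrightarrow> s \<le> (c_star \<gamma>)\<^sup>2 \<Longrightarrow> 0 < rho \<gamma> s"
  using rho_base_pos[of \<gamma> s] by (simp add: rho_def)

lemma rho_has_derivative:
  assumes "\<gamma> > 1" "s \<le> (c_star \<gamma>)\<^sup>2"
  shows "(rho \<gamma> has_real_derivative - ((1 - (\<gamma> - 1) / 2 * s) powr (1 / (\<gamma> - 1) - 1)) / 2) (at s)"
proof -
  have "(rho \<gamma> has_real_derivative
      1 / (\<gamma> - 1) * (1 - (\<gamma> - 1) / 2 * s) powr (1 / (\<gamma> - 1) - 1) * (- ((\<gamma> - 1) / 2))) (at s)"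
    unfolding rho_def
    by (rule DERIV_chain'[where g = "\<lambda>z. z powr (1 / (\<gamma> - 1))", rotated, OF has_real_derivative_powr])
      (use rho_base_pos[OF assms] in \<open>auto intro!: derivative_eq_intros\<close>)
  moreover have "1 / (\<gamma> - 1) * A * (- ((\<gamma> - 1) / 2)) = - A / 2" for A
    using assms(1) by simp
  ultimately show ?thesis by (simp only:)
qed

text \<open>
  The derivative of \<open>t * rho (t\<^sup>2)\<close> is a positive factor times \<open>1 - (\<gamma> + 1) / 2 * t\<^sup>2\<close>, which is
  positive precisely below the sonic speed.
\<close>

lemma mass_flux_strict_mono:
  assumes "\<gamma> > 1" "0 \<le> s" "s < t" "t \<le> c_star \<gamma>"
  shows "rho \<gamma> (s\<^sup>2) * s < rho \<gamma> (t\<^sup>2) * t"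
proof (rule DERIV_pos_imp_increasing_open[OF assms(3)])
  let ?p = "1 / (\<gamma> - 1)"
  let ?u = "\<lambda>x::real. 1 - (\<gamma> - 1) / 2 * x\<^sup>2"
  have sq: "x\<^sup>2 \<le> (c_star \<gamma>)\<^sup>2" if "s \<le> x" "x \<le> t" for x
    using that assms by (intro power_mono) auto
  have D: "((\<lambda>x. rho \<gamma> (x\<^sup>2) * x) has_real_derivative
      (- (?u x powr (?p - 1)) / 2 * (2 * x)) * x + 1 * rho \<gamma> (x\<^sup>2)) (at x)"
    if "s \<le> x" "x \<le> t" for x
    by (rule DERIV_mult[OF DERIV_chain'[where g = "rho \<gamma>" and f = "\<lambda>x. x\<^sup>2" and x = x, OF _ rho_has_derivative[OF assms(1) sq[OF that]]] DERIV_ident])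
      (auto intro!: derivative_eq_intros)
  show "continuous_on {s..t} (\<lambda>x. rho \<gamma> (x\<^sup>2) * x)"
    by (intro continuous_at_imp_continuous_on ballI DERIV_isCont[OF D]) auto
  fix x assume x: "s < x" "x < t"
  have u: "0 < ?u x" using rho_base_pos[OF assms(1) sq] x by auto
  then have r: "rho \<gamma> (x\<^sup>2) = ?u x powr (?p - 1) * ?u x"
    by (simp add: rho_def powr_diff)
  have "x\<^sup>2 < (c_star \<gamma>)\<^sup>2" using x assms by (intro power_strict_mono) auto
  then have "0 < ?u x - x\<^sup>2"
    using assms(1) by (simp add: c_star_sq field_simps)
  moreover have "(- (?u x powr (?p - 1)) / 2 * (2 * x)) * x + 1 * rho \<gamma> (x\<^sup>2)
      = ?u x powr (?p - 1) * (?u x - x\<^sup>2)"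
    unfolding r by (simp add: algebra_simps power2_eq_square)
  moreover have "0 < ?u x powr (?p - 1)" using u by simp
  ultimately have "0 < (- (?u x powr (?p - 1)) / 2 * (2 * x)) * x + 1 * rho \<gamma> (x\<^sup>2)"
    by (simp del: powr_gt_zero)
  then show "\<exists>y. ((\<lambda>x. rho \<gamma> (x\<^sup>2) * x) has_real_derivative y) (at x) \<and> y > 0"
    using D[of x] x by (intro exI[of _ "(- (?u x powr (?p - 1)) / 2 * (2 * x)) * x + 1 * rho \<gamma> (x\<^sup>2)"]) simp
qed

text \<open>
  With \<open>r = rho (|a|\<^sup>2)\<close> and \<open>s = rho (|b|\<^sup>2)\<close> the inner product equals
  \<open>(r|a| - s|b|) (|a| - |b|) + (r + s) (|a||b| - a \<bullet> b)\<close>. The first summand is nonnegative because the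
  flux grows with the speed, the second by the Cauchy-Schwarz inequality. If both vanish, the speeds
  and the directions agree.
\<close>

lemma mass_flux_monotone:
  fixes a b :: "'a::real_inner"
  assumes g: "\<gamma> > 1" and a: "norm a \<le> c_star \<gamma>" and b: "norm b \<le> c_star \<gamma>"
  shows "0 \<le> (mass_flux \<gamma> a - mass_flux \<gamma> b) \<bullet> (a - b)"
    and "(mass_flux \<gamma> a - mass_flux \<gamma> b) \<bullet> (a - b) = 0 \<Longrightarrow> a = b"
proof -
  define r s where "r = rho \<gamma> ((norm a)\<^sup>2)" and "s = rho \<gamma> ((norm b)\<^sup>2)"
  have pos: "0 < r" "0 < s"
    using a b by (auto simp: r_def s_def intro!: rho_pos[OF g] power_mono)
  define P where "P = (r * norm a - s * norm b) * (norm a - norm b)"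
  define R where "R = (r + s) * (norm a * norm b - a \<bullet> b)"
  have eq: "(mass_flux \<gamma> a - mass_flux \<gamma> b) \<bullet> (a - b) = P + R"
    unfolding mass_flux_def r_def[symmetric] s_def[symmetric] P_def R_def
    by (simp add: inner_diff_left inner_diff_right dot_square_norm inner_commute[of b a]
        algebra_simps power2_eq_square)
  have P: "0 < P" if "norm a \<noteq> norm b"
  proof (cases "norm a < norm b")
    case True
    then have "r * norm a < s * norm b"
      using mass_flux_strict_mono[OF g _ True b] by (simp add: r_def s_def)
    then show ?thesis using True by (simp add: P_def mult_neg_neg)
  next
    case False
    then have "norm b < norm a" using that by simp
    then have "s * norm b < r * norm a"
      using mass_flux_strict_mono[OF g _ _ a, of "norm b"] by (simp add: r_def s_def)
    then show ?thesis using \<open>norm b < norm a\<close> by (simp add: P_def)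
  qed
  have P0: "0 \<le> P" using P by (cases "norm a = norm b") (auto simp: P_def less_imp_le)
  have R0: "0 \<le> R" using pos norm_cauchy_schwarz[of a b] by (simp add: R_def)
  show "0 \<le> (mass_flux \<gamma> a - mass_flux \<gamma> b) \<bullet> (a - b)" using eq P0 R0 by simp
  assume "(mass_flux \<gamma> a - mass_flux \<gamma> b) \<bullet> (a - b) = 0"
  then have "P = 0" "R = 0" using eq P0 R0 by auto
  then have n: "norm a = norm b" and "a \<bullet> b = norm a * norm b"
    using P pos by (auto simp: R_def)
  then have "norm a *\<^sub>R b = norm b *\<^sub>R a" using norm_cauchy_schwarz_eq by blast
  then show "a = b" using n by (metis norm_eq_zero scaleR_cancel_left)
qed

text \<open>
  Up to and including the sonic speed the base of the power in \<open>rho\<close> stays away from zero, so \<open>rho\<close>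
  has a bounded derivative there even when its exponent is smaller than one.
\<close>

lemma mass_flux_lipschitz:
  assumes g: "\<gamma> > 1"
  obtains L where "0 \<le> L" "\<And>a b :: 'a::real_inner. norm a \<le> c_star \<gamma> \<Longrightarrow> norm b \<le> c_star \<gamma> \<Longrightarrow>
     norm (mass_flux \<gamma> a - mass_flux \<gamma> b) \<le> L * norm (a - b)"
proof -
  let ?c = "c_star \<gamma>"
  let ?d = "\<lambda>s. - ((1 - (\<gamma> - 1) / 2 * s) powr (1 / (\<gamma> - 1) - 1)) / 2"
  have c: "0 < ?c" by (rule c_star_pos[OF g])
  have "continuous_on {0..?c\<^sup>2} ?d"
    using rho_base_pos[OF g] by (intro continuous_intros) force+
  then have "bounded (?d ` {0..?c\<^sup>2})"
    by (intro compact_imp_bounded compact_continuous_image) auto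
  then obtain B where B: "0 < B" "\<And>s. s \<in> {0..?c\<^sup>2} \<Longrightarrow> norm (?d s) \<le> B"
    unfolding bounded_pos by auto
  have lip: "norm (rho \<gamma> s - rho \<gamma> t) \<le> B * norm (s - t)" if "s \<in> {0..?c\<^sup>2}" "t \<in> {0..?c\<^sup>2}" for s t
    by (rule field_differentiable_bound[OF convex_real_interval(5) _ B(2) that])
      (use rho_has_derivative[OF g] in \<open>auto intro: has_field_derivative_at_within\<close>)
  show ?thesis
  proof (rule that[of "rho \<gamma> 0 + 3 * B * ?c\<^sup>2"])
    show "0 \<le> rho \<gamma> 0 + 3 * B * ?c\<^sup>2" using B by (simp add: rho_def)
    fix a b :: 'a assume a: "norm a \<le> ?c" and b: "norm b \<le> ?c"
    have ia: "(norm a)\<^sup>2 \<in> {0..?c\<^sup>2}" and ib: "(norm b)\<^sup>2 \<in> {0..?c\<^sup>2}"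
      using a b by (auto intro: power_mono)
    let ?n = "norm (a - b)"
    have "norm (rho \<gamma> ((norm a)\<^sup>2) - rho \<gamma> ((norm b)\<^sup>2)) \<le> B * \<bar>(norm a)\<^sup>2 - (norm b)\<^sup>2\<bar>"
      using lip[OF ia ib] by simp
    also have "\<bar>(norm a)\<^sup>2 - (norm b)\<^sup>2\<bar> = (norm a + norm b) * \<bar>norm a - norm b\<bar>"
      by (simp add: power2_eq_square square_diff_square_factored abs_mult)
    also have "\<dots> \<le> (?c + ?c) * ?n"
      using a b c by (intro mult_mono norm_triangle_ineq3) auto
    finally have 1: "\<bar>rho \<gamma> ((norm a)\<^sup>2) - rho \<gamma> ((norm b)\<^sup>2)\<bar> \<le> B * ((?c + ?c) * ?n)"
      using B by (simp add: mult_left_mono)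
    have "\<bar>rho \<gamma> ((norm a)\<^sup>2) - rho \<gamma> 0\<bar> \<le> B * ?c\<^sup>2"
      using lip[OF ia, of 0] ia B by (simp add: order_trans[OF _ mult_left_mono])
    then have 2: "\<bar>rho \<gamma> ((norm a)\<^sup>2)\<bar> \<le> rho \<gamma> 0 + B * ?c\<^sup>2"
      by (simp add: rho_def)
    have "mass_flux \<gamma> a - mass_flux \<gamma> b = rho \<gamma> ((norm a)\<^sup>2) *\<^sub>R (a - b)
        + (rho \<gamma> ((norm a)\<^sup>2) - rho \<gamma> ((norm b)\<^sup>2)) *\<^sub>R b"
      by (simp add: mass_flux_def algebra_simps)
    then have "norm (mass_flux \<gamma> a - mass_flux \<gamma> b) \<le> \<bar>rho \<gamma> ((norm a)\<^sup>2)\<bar> * ?n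
        + \<bar>rho \<gamma> ((norm a)\<^sup>2) - rho \<gamma> ((norm b)\<^sup>2)\<bar> * norm b"
      by (metis norm_triangle_ineq norm_scaleR)
    also have "\<dots> \<le> (rho \<gamma> 0 + B * ?c\<^sup>2) * ?n + B * ((?c + ?c) * ?n) * ?c"
      using 1 2 b B c by (intro add_mono mult_mono) auto
    also have "\<dots> = (rho \<gamma> 0 + 3 * B * ?c\<^sup>2) * ?n"
      by (simp add: algebra_simps power2_eq_square)
    finally show "norm (mass_flux \<gamma> a - mass_flux \<gamma> b) \<le> (rho \<gamma> 0 + 3 * B * ?c\<^sup>2) * ?n" .
  qed
qed

section \<open>Truncation functions on the line\<close>

text \<open>
  A \<open>C\<^sup>1\<close> function that is zero on \<open>t \<le> 1\<close> and tends to one at infinity. It never reaches one; in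
  exchange a single formula describes it on the whole line.
\<close>

definition cutoff :: "real \<Rightarrow> real" where
  "cutoff t = (max 0 (t - 1))\<^sup>2 / (1 + (max 0 (t - 1))\<^sup>2)"

definition cutoff_deriv :: "real \<Rightarrow> real" where
  "cutoff_deriv t = 2 * max 0 (t - 1) / (1 + (max 0 (t - 1))\<^sup>2)\<^sup>2"

lemma max_square_has_derivative:
  "((\<lambda>t::real. (max 0 t)\<^sup>2) has_real_derivative 2 * max 0 t) (at t)"
proof -
  consider "t < 0" | "t > 0" | "t = 0" by linarith
  then show ?thesis
  proof cases
    case 1
    then have "eventually (\<lambda>s. (max 0 s)\<^sup>2 = 0) (nhds t)"
      by (intro eventually_mono[OF eventually_nhds_in_open[of "{..<0}"]]) auto
    then show ?thesis using 1 by (subst DERIV_cong_ev[OF refl _ refl, of _ "\<lambda>_. 0"]) auto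
  next
    case 2
    then have "eventually (\<lambda>s. (max 0 s)\<^sup>2 = s\<^sup>2) (nhds t)"
      by (intro eventually_mono[OF eventually_nhds_in_open[of "{0<..}"]]) auto
    then show ?thesis using 2
      by (subst DERIV_cong_ev[OF refl _ refl, of _ "\<lambda>s. s\<^sup>2"]) (auto intro!: derivative_eq_intros)
  next
    case 3
    have "((\<lambda>s::real. (max 0 s)\<^sup>2 / s) \<longlongrightarrow> 0) (at 0)"
    proof (rule tendsto_sandwich[of "\<lambda>s. - \<bar>s\<bar>" _ _ "\<lambda>s. \<bar>s\<bar>"])
      show "\<forall>\<^sub>F s in at (0::real). - \<bar>s\<bar> \<le> (max 0 s)\<^sup>2 / s" "\<forall>\<^sub>F s in at (0::real). (max 0 s)\<^sup>2 / s \<le> \<bar>s\<bar>"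
        by (auto simp: max_def power2_eq_square intro!: always_eventually)
    qed (auto intro!: tendsto_eq_intros)
    then show ?thesis using 3 by (simp add: has_field_derivative_iff)
  qed
qed

lemma cutoff_has_derivative: "(cutoff has_real_derivative cutoff_deriv t) (at t)"
proof -
  have D: "((\<lambda>t. (max 0 (t - 1))\<^sup>2) has_real_derivative 2 * max 0 (t - 1)) (at t)"
    using DERIV_shift[of "\<lambda>t. (max 0 t)\<^sup>2" "2 * max 0 (t - 1)" t "- 1"]
      max_square_has_derivative[of "t - 1"] by simp
  have "0 < 1 + (max 0 (t - 1))\<^sup>2" by (intro add_pos_nonneg) auto
  then show ?thesis
    unfolding cutoff_def cutoff_deriv_def
    by (intro DERIV_cong[OF DERIV_divide[OF D DERIV_add[OF DERIV_const D]]])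
      (auto simp: power2_eq_square algebra_simps)
qed

lemma cutoff_bounds: "0 \<le> cutoff t" "cutoff t \<le> 1"
proof -
  have "0 < 1 + (max 0 (t - 1))\<^sup>2" by (intro add_pos_nonneg) auto
  then show "0 \<le> cutoff t" "cutoff t \<le> 1" by (simp_all add: cutoff_def)
qed

lemma cutoff_eq_0: "t \<le> 1 \<Longrightarrow> cutoff t = 0"
  by (simp add: cutoff_def)

lemma continuous_on_cutoff_deriv: "continuous_on A cutoff_deriv"
proof -
  have "0 < 1 + (max 0 (t - 1))\<^sup>2" for t :: real
    by (intro add_pos_nonneg) auto
  then have "(1 + (max 0 (t - 1))\<^sup>2)\<^sup>2 \<noteq> 0" for t :: real
    by (metis less_irrefl power_not_zero)
  then show ?thesis
    unfolding cutoff_deriv_def[abs_def] by (intro continuous_intros) auto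
qed

text \<open>
  The rescaled cutoff \<open>t \<mapsto> cutoff (n t)\<close> has derivative \<open>n cutoff_deriv (n t)\<close>. By the first estimate,
  \<open>t\<close> times this derivative is bounded uniformly in \<open>n\<close>; by the other two, the derivative tends to
  zero and the rescaled cutoff to one for each fixed \<open>t > 0\<close>. These are the majorant and the pointwise
  limits for a dominated convergence.
\<close>

lemma cutoff_deriv_decay:
  assumes "0 < t"
  shows "\<bar>cutoff_deriv t\<bar> * t \<le> 4" "\<bar>cutoff_deriv t\<bar> * t \<le> 4 / t" "\<bar>1 - cutoff t\<bar> \<le> 2 / t"
proof -
  define s where "s = max 0 (t - 1)"
  have s: "0 \<le> s" "t \<le> s + 1" by (auto simp: s_def)
  have q: "0 < 1 + s\<^sup>2" by (intro add_pos_nonneg) auto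
  have cd: "\<bar>cutoff_deriv t\<bar> = 2 * s / (1 + s\<^sup>2)\<^sup>2"
    using s q by (simp add: cutoff_deriv_def s_def)
  have c: "\<bar>1 - cutoff t\<bar> = 1 / (1 + s\<^sup>2)"
    using q by (simp add: cutoff_def s_def field_simps)
  have 1: "2 * s * (s + 1)\<^sup>2 \<le> 4 * (1 + s\<^sup>2)\<^sup>2" and 2: "2 * s * (s + 1) \<le> 4 * (1 + s\<^sup>2)\<^sup>2"
    and 3: "s + 1 \<le> 2 * (1 + s\<^sup>2)"
  proof -
    have "0 \<le> (s - 1)\<^sup>2" "0 \<le> (s\<^sup>2 - s)\<^sup>2" by auto
    then have "2 * s \<le> s\<^sup>2 + 1" "2 * (s * s\<^sup>2) \<le> s\<^sup>2 + s\<^sup>2 * s\<^sup>2" 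
      by (auto simp: power2_eq_square algebra_simps)
    moreover have "0 \<le> s\<^sup>2" "0 \<le> s\<^sup>2 * s\<^sup>2" by auto
    moreover have "4 * (1 + s\<^sup>2)\<^sup>2 = 4 + 8 * s\<^sup>2 + 4 * (s\<^sup>2 * s\<^sup>2)"
      "2 * s * (s + 1)\<^sup>2 = 2 * (s * s\<^sup>2) + 4 * s\<^sup>2 + 2 * s" "2 * s * (s + 1) = 2 * s\<^sup>2 + 2 * s"
      by (auto simp: power2_eq_square algebra_simps)
    ultimately show "2 * s * (s + 1)\<^sup>2 \<le> 4 * (1 + s\<^sup>2)\<^sup>2" "2 * s * (s + 1) \<le> 4 * (1 + s\<^sup>2)\<^sup>2" using s by linarith+
    have "s \<le> 1 + s * s" using s zero_le_square[of "s - 1"] by (auto simp: algebra_simps)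
    moreover have "0 \<le> s * s" by simp
    moreover have "2 * (1 + s\<^sup>2) = 2 + 2 * (s * s)" by (simp add: power2_eq_square)
    ultimately show "s + 1 \<le> 2 * (1 + s\<^sup>2)" by linarith
  qed
  have "2 * s * t \<le> 2 * s * (s + 1)" using s by (intro mult_left_mono) auto
  then show "\<bar>cutoff_deriv t\<bar> * t \<le> 4"
    using 2 q by (simp add: cd divide_le_eq)
  have "2 * s * t\<^sup>2 \<le> 2 * s * (s + 1)\<^sup>2" using s assms by (intro mult_left_mono power_mono) auto
  then have "2 * s * t\<^sup>2 / (1 + s\<^sup>2)\<^sup>2 \<le> 4"
    using 1 q by (simp add: divide_le_eq)
  then show "\<bar>cutoff_deriv t\<bar> * t \<le> 4 / t"
    using assms by (simp add: cd le_divide_eq power2_eq_square mult.assoc)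
  show "\<bar>1 - cutoff t\<bar> \<le> 2 / t"
    using 3 s q assms by (simp add: c field_simps)
qed

text \<open>
  A nondecreasing \<open>C\<^sup>1\<close> function that is zero on \<open>[-\<epsilon>, \<epsilon>]\<close> and strictly increasing outside, for
  \<open>\<epsilon> \<ge> 0\<close>.
\<close>

definition soft_threshold :: "real \<Rightarrow> real \<Rightarrow> real" where
  "soft_threshold \<epsilon> t = (max 0 (t - \<epsilon>))\<^sup>2 - (max 0 (- t - \<epsilon>))\<^sup>2"

definition soft_threshold_deriv :: "real \<Rightarrow> real \<Rightarrow> real" where
  "soft_threshold_deriv \<epsilon> t = 2 * max 0 (t - \<epsilon>) + 2 * max 0 (- t - \<epsilon>)"

lemma soft_threshold_has_derivative:
  "(soft_threshold \<epsilon> has_real_derivative soft_threshold_deriv \<epsilon> t) (at t)"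
proof -
  have 1: "((\<lambda>t. (max 0 (t - \<epsilon>))\<^sup>2) has_real_derivative 2 * max 0 (t - \<epsilon>) * 1) (at t)"
    by (rule DERIV_chain2[of "\<lambda>t. (max 0 t)\<^sup>2" _ "\<lambda>t. t - \<epsilon>", OF max_square_has_derivative])
      (auto intro!: derivative_eq_intros)
  have 2: "((\<lambda>t. (max 0 (- t - \<epsilon>))\<^sup>2) has_real_derivative 2 * max 0 (- t - \<epsilon>) * - 1) (at t)"
    by (rule DERIV_chain2[of "\<lambda>t. (max 0 t)\<^sup>2" _ "\<lambda>t. - t - \<epsilon>", OF max_square_has_derivative])
      (auto intro!: derivative_eq_intros)
  show ?thesis
    unfolding soft_threshold_def[abs_def] soft_threshold_deriv_def
    using DERIV_diff[OF 1 2] by simp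
qed

lemma continuous_on_soft_threshold_deriv: "continuous_on A (soft_threshold_deriv \<epsilon>)"
  unfolding soft_threshold_deriv_def[abs_def] by (intro continuous_intros)

section \<open>Weakly divergence free fields\<close>

lemma set_integrable_bounded_continuous:
  fixes h :: "'a::euclidean_space \<Rightarrow> real"
  assumes "open \<Omega>" "bounded \<Omega>" "continuous_on \<Omega> h" "\<And>z. z \<in> \<Omega> \<Longrightarrow> \<bar>h z\<bar> \<le> M"
  shows "set_integrable lborel \<Omega> h"
  unfolding set_integrable_def
proof (rule Bochner_Integration.integrable_bound)
  show "integrable lborel (\<lambda>z. \<bar>M\<bar> * indicat_real \<Omega> z)"
    using assms(1,2) emeasure_bounded_finite[of \<Omega>] by simp
  show "(\<lambda>z. indicat_real \<Omega> z *\<^sub>R h z) \<in> borel_measurable lborel"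
    using borel_measurable_continuous_on_indicator[of \<Omega> h] assms by simp
  show "AE z in lborel. norm (indicat_real \<Omega> z *\<^sub>R h z) \<le> norm (\<bar>M\<bar> * indicat_real \<Omega> z)"
    using assms(4) by (intro always_eventually allI) (force simp: indicator_def)
qed

text \<open>
  The set where the continuous function is positive is open and negligible, hence empty.
\<close>

lemma set_integral_nonneg_eq_0_open:
  fixes h :: "'a::euclidean_space \<Rightarrow> real"
  assumes \<Omega>: "open \<Omega>" "bounded \<Omega>" and h: "continuous_on \<Omega> h" "\<And>z. z \<in> \<Omega> \<Longrightarrow> 0 \<le> h z"
    and M: "\<And>z. z \<in> \<Omega> \<Longrightarrow> h z \<le> M"
    and int: "(LINT z:\<Omega>|lborel. h z) = 0" and z: "z \<in> \<Omega>"
  shows "h z = 0"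
proof (rule ccontr)
  assume "h z \<noteq> 0"
  let ?A = "\<Omega> \<inter> h -` {0<..}"
  have oA: "open ?A"
    using continuous_open_preimage[OF h(1) \<Omega>(1), of "{0<..}"] by simp
  have "set_integrable lborel \<Omega> h"
    using set_integrable_bounded_continuous[OF \<Omega> h(1), of M] h(2) M by auto
  then have "AE z in lborel. indicator \<Omega> z *\<^sub>R h z = 0"
    using int h(2) unfolding set_integrable_def set_lebesgue_integral_def
    by (subst (asm) integral_nonneg_eq_0_iff_AE) (auto simp: indicator_def)
  then have "AE z in lborel. z \<notin> ?A"
    by eventually_elim auto
  then have "?A \<in> null_sets lborel"
    using oA by (subst (asm) AE_iff_null_sets[symmetric]) auto
  then have "negligible ?A"
    by (simp add: negligible_iff_null_sets null_sets_completionI)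
  moreover have "z \<in> ?A" using z h(2)[OF z] \<open>h z \<noteq> 0\<close> by auto
  ultimately show False using open_not_negligible[OF oA] by auto
qed

lemma set_integrable_continuous_closure:
  fixes h :: "'a::euclidean_space \<Rightarrow> real"
  assumes "open \<Omega>" "bounded \<Omega>" "continuous_on (closure \<Omega>) h"
  shows "set_integrable lborel \<Omega> h"
proof -
  have "bounded (h ` closure \<Omega>)"
    using assms by (intro compact_imp_bounded compact_continuous_image) (auto simp: compact_closure)
  then obtain M where "\<And>z. z \<in> closure \<Omega> \<Longrightarrow> \<bar>h z\<bar> \<le> M"
    unfolding bounded_iff by (metis imageI real_norm_def)
  then show ?thesis
    using assms closure_subset[of \<Omega>]
    by (intro set_integrable_bounded_continuous[of _ _ M] continuous_on_subset[OF assms(3)]) auto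
qed

lemma weakly_div_free_diff:
  assumes \<Omega>: "open \<Omega>" "bounded \<Omega>"
    and p: "weakly_div_free \<Omega> p" "continuous_on (closure \<Omega>) p"
    and q: "weakly_div_free \<Omega> q" "continuous_on (closure \<Omega>) q"
  shows "weakly_div_free \<Omega> (\<lambda>z. p z - q z)"
  unfolding weakly_div_free_def
proof (intro allI impI)
  fix \<eta> \<eta>' assume t: "test_function \<Omega> \<eta> \<eta>'"
  then have c: "continuous_on (closure \<Omega>) \<eta>'"
    by (auto simp: test_function_def intro: continuous_on_subset)
  have "(LINT z:\<Omega>|lborel. p z \<bullet> \<eta>' z - q z \<bullet> \<eta>' z)
      = (LINT z:\<Omega>|lborel. p z \<bullet> \<eta>' z) - (LINT z:\<Omega>|lborel. q z \<bullet> \<eta>' z)"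
    by (intro set_integral_diff(2) set_integrable_continuous_closure \<Omega> continuous_intros p q c)
  then show "(LINT z:\<Omega>|lborel. (p z - q z) \<bullet> \<eta>' z) = 0"
    using p(1) q(1) t by (simp add: weakly_div_free_def inner_diff_left)
qed

lemma GDERIV_of_locally_zero:
  assumes "open S" "z \<in> S" "\<And>w. w \<in> S \<Longrightarrow> \<eta> w = (0::real)" 
  shows "GDERIV \<eta> z :> D \<longleftrightarrow> D = 0"
proof -
  have "((\<lambda>_. 0) has_derivative (\<lambda>h. h \<bullet> D)) (at z) \<longleftrightarrow> D = 0"
  proof
    assume "((\<lambda>_. 0) has_derivative (\<lambda>h. h \<bullet> D)) (at z)"
    then have "(\<lambda>h. h \<bullet> D) = (\<lambda>_. 0)"
      using has_derivative_unique has_derivative_const by blast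
    then have "D \<bullet> D = 0" by metis
    then show "D = 0" by simp
  qed simp
  moreover have "(\<eta> has_derivative (\<lambda>h. h \<bullet> D)) (at z) \<longleftrightarrow> ((\<lambda>_. 0) has_derivative (\<lambda>h. h \<bullet> D)) (at z)"
    using assms has_derivative_transform_within_open[OF _ assms(1,2), of \<eta> _ UNIV "\<lambda>_. 0"]
      has_derivative_transform_within_open[OF _ assms(1,2), of "\<lambda>_. 0" _ UNIV \<eta>] by auto
  ultimately show ?thesis by (simp add: gderiv_def)
qed

text \<open>
  The extension by zero is \<open>C\<^sup>1\<close> because \<open>\<Omega>\<close> and the complement of \<open>K\<close> are open, cover the plane, and
  the extension has a continuous gradient on each of them.
\<close>

lemma test_function_extension:
  assumes "open \<Omega>" and K: "compact K" "K \<subseteq> \<Omega>" "\<And>z. z \<in> \<Omega> \<Longrightarrow> z \<notin> K \<Longrightarrow> h z = 0"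
    and D: "\<And>z. z \<in> \<Omega> \<Longrightarrow> GDERIV h z :> h' z" and c: "continuous_on \<Omega> h'"
  shows "test_function \<Omega> (\<lambda>z. if z \<in> \<Omega> then h z else 0) (\<lambda>z. if z \<in> \<Omega> then h' z else 0)"
  unfolding test_function_def
proof (intro conjI allI)
  let ?h = "\<lambda>z. if z \<in> \<Omega> then h z else 0" and ?h' = "\<lambda>z. if z \<in> \<Omega> then h' z else 0"
  have oK: "open (- K)" using K(1) by (simp add: compact_imp_closed open_Compl)
  have in_\<Omega>: "GDERIV ?h z :> h' z" if "z \<in> \<Omega>" for z
    using D[OF that] unfolding gderiv_def
    by (rule has_derivative_transform_within_open[OF _ assms(1) that]) auto
  \<comment> \<open>Inside the domain but off K this is the uniqueness of the derivative of a locally constant function.\<close>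
  have h'0: "?h' z = 0" if "z \<notin> K" for z
    using in_\<Omega>[of z] GDERIV_of_locally_zero[of "- K" z ?h "h' z"] oK that K(3) by auto
  show "GDERIV ?h z :> ?h' z" for z
  proof (cases "z \<in> \<Omega>")
    case True then show ?thesis using in_\<Omega> by simp
  next
    case False
    have "GDERIV ?h z :> 0"
      by (subst GDERIV_of_locally_zero[OF oK]) (use False K in auto)
    then show ?thesis using False by simp
  qed
  have "continuous_on \<Omega> ?h'" using c by (rule continuous_on_eq) simp
  moreover have "continuous_on (- K) ?h'"
    by (rule continuous_on_eq[of _ "\<lambda>_. 0"]) (use h'0 in auto)
  ultimately have "continuous_on (\<Omega> \<union> - K) ?h'"
    by (intro continuous_on_open_Un assms(1) oK)
  moreover have "\<Omega> \<union> - K = UNIV" using K(2) by auto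
  ultimately show "continuous_on UNIV ?h'" by simp
  show "\<exists>K. compact K \<and> K \<subseteq> \<Omega> \<and> (\<forall>z. z \<notin> K \<longrightarrow> ?h z = 0)"
    using K by auto
qed

text \<open>
  Integration by parts without a boundary term. The weight \<open>D\<close> measures the distance to the part of
  the boundary where \<open>u\<close> need not vanish, and the bound on \<open>Q \<bullet> \<nabla>D\<close> expresses that \<open>Q\<close> has no normal
  component on that part. The test functions are \<open>u * cutoff (n * D)\<close>. The term that contains the
  gradient of the cutoff is \<open>u * n * cutoff_deriv (n * D) * (Q \<bullet> \<nabla>D)\<close>; it is bounded by a multiple
  of \<open>n * D * cutoff_deriv (n * D)\<close>, so it is bounded uniformly in \<open>n\<close> and tends to zero pointwise.
\<close>

lemma weakly_div_free_integral_gradient: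
  fixes Q :: "real \<times> real \<Rightarrow> real \<times> real"
  assumes \<Omega>: "open \<Omega>" "bounded \<Omega>"
    and Q: "weakly_div_free \<Omega> Q" "continuous_on \<Omega> Q" "\<And>z. z \<in> \<Omega> \<Longrightarrow> norm (Q z) \<le> B"
    and D: "\<And>z. z \<in> \<Omega> \<Longrightarrow> GDERIV D z :> D' z" "continuous_on \<Omega> D'"
    and Dpos: "\<And>z. z \<in> \<Omega> \<Longrightarrow> 0 < D z"
    and QD: "\<And>z. z \<in> \<Omega> \<Longrightarrow> \<bar>Q z \<bullet> D' z\<bar> \<le> C * D z"
    and u: "\<And>z. z \<in> \<Omega> \<Longrightarrow> GDERIV u z :> u' z" "continuous_on \<Omega> u'"
    and ub: "\<And>z. z \<in> \<Omega> \<Longrightarrow> \<bar>u z\<bar> \<le> Bu" "\<And>z. z \<in> \<Omega> \<Longrightarrow> norm (u' z) \<le> Bu'"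
    and K: "\<And>\<delta>. \<delta> > 0 \<Longrightarrow> \<exists>K. compact K \<and> K \<subseteq> \<Omega> \<and> (\<forall>z\<in>\<Omega> - K. \<delta> < D z \<longrightarrow> u z = 0)"
  shows "(LINT z:\<Omega>|lborel. Q z \<bullet> u' z) = 0"
proof -
  define a where "a n = real (Suc n)" for n
  have a: "0 < a n" for n by (simp add: a_def)
  define h where "h n z = u z * cutoff (a n * D z)" for n z
  define h' where "h' n z = u z *\<^sub>R (cutoff_deriv (a n * D z) *\<^sub>R (a n *\<^sub>R D' z))
      + cutoff (a n * D z) *\<^sub>R u' z" for n z
  have cont: "continuous_on \<Omega> D" "continuous_on \<Omega> u"
    using D(1) u(1) has_derivative_continuous unfolding gderiv_def
    by (blast intro: continuous_at_imp_continuous_on)+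
  have cc: "continuous_on A cutoff" for A
    using cutoff_has_derivative by (blast intro: continuous_at_imp_continuous_on DERIV_isCont)
  have h'cont: "continuous_on \<Omega> (h' n)" for n
    unfolding h'_def
    by (intro continuous_intros cont u(2) D(2) continuous_on_compose2[OF continuous_on_cutoff_deriv[of UNIV]]
        continuous_on_compose2[OF cc[of UNIV]]) auto
  have Dh: "GDERIV (h n) z :> h' n z" if "z \<in> \<Omega>" for n z
    unfolding h_def h'_def
  proof (rule GDERIV_mult[OF u(1)[OF that]])
    have "GDERIV (\<lambda>z. a n * D z) z :> a n *\<^sub>R D' z"
      using GDERIV_mult[OF GDERIV_const D(1)[OF that], of "a n"] by simp
    then show "GDERIV (\<lambda>z. cutoff (a n * D z)) z :> cutoff_deriv (a n * D z) *\<^sub>R (a n *\<^sub>R D' z)"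
      by (rule GDERIV_DERIV_compose[OF _ cutoff_has_derivative])
  qed
  have tf: "test_function \<Omega> (\<lambda>z. if z \<in> \<Omega> then h n z else 0) (\<lambda>z. if z \<in> \<Omega> then h' n z else 0)" for n
  proof -
    obtain K0 where K0: "compact K0" "K0 \<subseteq> \<Omega>" "\<forall>z\<in>\<Omega> - K0. 1 / a n < D z \<longrightarrow> u z = 0"
      using K[of "1 / a n"] a by auto
    have "h n z = 0" if "z \<in> \<Omega>" "z \<notin> K0" for z
    proof (cases "1 / a n < D z")
      case True then show ?thesis using K0 that by (simp add: h_def)
    next
      case False
      then have "a n * D z \<le> 1" using a[of n] by (simp add: field_simps)
      then show ?thesis by (simp add: h_def cutoff_eq_0)
    qed
    then show ?thesis
      by (intro test_function_extension[OF \<Omega>(1) K0(1,2)] Dh h'cont)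
  qed
  have zero: "(LINT z:\<Omega>|lborel. Q z \<bullet> h' n z) = 0" for n
  proof -
    have "(LINT z:\<Omega>|lborel. Q z \<bullet> (if z \<in> \<Omega> then h' n z else 0)) = 0"
      using Q(1) tf unfolding weakly_div_free_def by blast
    moreover have "(LINT z:\<Omega>|lborel. Q z \<bullet> (if z \<in> \<Omega> then h' n z else 0)) = (LINT z:\<Omega>|lborel. Q z \<bullet> h' n z)"
      unfolding set_lebesgue_integral_def by (intro Bochner_Integration.integral_cong) auto
    ultimately show ?thesis by simp
  qed
  have eq: "Q z \<bullet> h' n z = u z * ((cutoff_deriv (a n * D z) * a n) * (Q z \<bullet> D' z))
      + cutoff (a n * D z) * (Q z \<bullet> u' z)" for n z
    by (simp add: h'_def inner_add_right algebra_simps)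
  have first: "\<bar>(cutoff_deriv (a n * D z) * a n) * (Q z \<bullet> D' z)\<bar> \<le> \<bar>C\<bar> * (\<bar>cutoff_deriv (a n * D z)\<bar> * (a n * D z))"
    if "z \<in> \<Omega>" for n z
  proof -
    have "\<bar>Q z \<bullet> D' z\<bar> \<le> \<bar>C\<bar> * D z"
      using QD[OF that] Dpos[OF that] by (meson abs_ge_self mult_right_mono order_trans less_imp_le)
    then have "(\<bar>cutoff_deriv (a n * D z)\<bar> * a n) * \<bar>Q z \<bullet> D' z\<bar>
        \<le> (\<bar>cutoff_deriv (a n * D z)\<bar> * a n) * (\<bar>C\<bar> * D z)"
      using a[of n] by (intro mult_left_mono) auto
    then show ?thesis using a[of n] by (simp add: abs_mult mult_ac)
  qed
  have lim: "(\<lambda>n. Q z \<bullet> h' n z) \<longlonglongrightarrow> Q z \<bullet> u' z" if z: "z \<in> \<Omega>" for z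
  proof -
    have "(\<lambda>n. 1 / (a n * D z)) \<longlonglongrightarrow> 0"
      using tendsto_mult[OF LIMSEQ_inverse_real_of_nat tendsto_const[of "1 / D z"]] Dpos[OF z]
      by (simp add: a_def divide_simps)
    then have l0: "(\<lambda>n. c * (1 / (a n * D z))) \<longlonglongrightarrow> 0" for c
      by (rule tendsto_mult_right_zero)
    have p: "0 < a n * D z" for n using a Dpos[OF z] by simp
    have 1: "(\<lambda>n. (cutoff_deriv (a n * D z) * a n) * (Q z \<bullet> D' z)) \<longlonglongrightarrow> 0"
    proof (rule Lim_null_comparison[OF always_eventually l0[of "4 * \<bar>C\<bar>"]], rule allI)
      fix n
      have "\<bar>C\<bar> * (\<bar>cutoff_deriv (a n * D z)\<bar> * (a n * D z)) \<le> \<bar>C\<bar> * (4 / (a n * D z))"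
        using cutoff_deriv_decay(2)[OF p[of n]] by (intro mult_left_mono) auto
      then show "norm ((cutoff_deriv (a n * D z) * a n) * (Q z \<bullet> D' z)) \<le> 4 * \<bar>C\<bar> * (1 / (a n * D z))"
        using first[OF z, of n] by (simp add: mult.commute[of 4])
    qed
    have "(\<lambda>n. 1 - cutoff (a n * D z)) \<longlonglongrightarrow> 0"
      by (rule Lim_null_comparison[OF always_eventually l0[of 2]])
        (use cutoff_deriv_decay(3)[OF p] in auto)
    then have 2: "(\<lambda>n. cutoff (a n * D z)) \<longlonglongrightarrow> 1"
      using tendsto_diff[OF tendsto_const[of 1]] by fastforce
    show ?thesis
      unfolding eq
      using tendsto_add[OF tendsto_mult_right_zero[OF 1, of "u z"] tendsto_mult_left[OF 2, of "Q z \<bullet> u' z"]]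
      by (simp add: mult.commute)
  qed
  have bound: "\<bar>Q z \<bullet> h' n z\<bar> \<le> \<bar>Bu\<bar> * (\<bar>C\<bar> * 4) + \<bar>B\<bar> * \<bar>Bu'\<bar>" if z: "z \<in> \<Omega>" for n z
  proof -
    have p: "0 < a n * D z" using a Dpos[OF z] by simp
    have "\<bar>(cutoff_deriv (a n * D z) * a n) * (Q z \<bullet> D' z)\<bar> \<le> \<bar>C\<bar> * 4"
      using first[OF z, of n] mult_left_mono[OF cutoff_deriv_decay(1)[OF p], of "\<bar>C\<bar>"] by simp
    then have 1: "\<bar>u z\<bar> * \<bar>(cutoff_deriv (a n * D z) * a n) * (Q z \<bullet> D' z)\<bar> \<le> \<bar>Bu\<bar> * (\<bar>C\<bar> * 4)"
      using ub(1)[OF z] by (intro mult_mono) auto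
    have "\<bar>Q z \<bullet> u' z\<bar> \<le> norm (Q z) * norm (u' z)" by (rule Cauchy_Schwarz_ineq2)
    also have "\<dots> \<le> \<bar>B\<bar> * \<bar>Bu'\<bar>" 
      using Q(3)[OF z] ub(2)[OF z] by (intro mult_mono) auto
    finally have "cutoff (a n * D z) * \<bar>Q z \<bullet> u' z\<bar> \<le> 1 * (\<bar>B\<bar> * \<bar>Bu'\<bar>)"
      using cutoff_bounds by (intro mult_mono) auto
    then show ?thesis
      unfolding eq using 1 cutoff_bounds(1)[of "a n * D z"]
      by (intro order_trans[OF abs_triangle_ineq add_mono]) (auto simp: abs_mult)
  qed
  have "(\<lambda>n. LINT z|lborel. indicat_real \<Omega> z *\<^sub>R (Q z \<bullet> h' n z)) \<longlonglongrightarrow>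
      (LINT z|lborel. indicat_real \<Omega> z *\<^sub>R (Q z \<bullet> u' z))"
  proof (rule integral_dominated_convergence[where w = "\<lambda>z. (\<bar>Bu\<bar> * (\<bar>C\<bar> * 4) + \<bar>B\<bar> * \<bar>Bu'\<bar>) * indicat_real \<Omega> z"])
    show "(\<lambda>z. indicat_real \<Omega> z *\<^sub>R (Q z \<bullet> u' z)) \<in> borel_measurable lborel"
      using borel_measurable_continuous_on_indicator[of \<Omega> "\<lambda>z. Q z \<bullet> u' z"] \<Omega>(1) Q(2) u(2)
      by (simp add: continuous_intros)
    show "(\<lambda>z. indicat_real \<Omega> z *\<^sub>R (Q z \<bullet> h' n z)) \<in> borel_measurable lborel" for n
      using borel_measurable_continuous_on_indicator[of \<Omega> "\<lambda>z. Q z \<bullet> h' n z"] \<Omega>(1) Q(2) h'cont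
      by (simp add: continuous_intros)
    show "integrable lborel (\<lambda>z. (\<bar>Bu\<bar> * (\<bar>C\<bar> * 4) + \<bar>B\<bar> * \<bar>Bu'\<bar>) * indicat_real \<Omega> z)"
      using \<Omega> emeasure_bounded_finite[of \<Omega>] by simp
    show "AE z in lborel. (\<lambda>n. indicat_real \<Omega> z *\<^sub>R (Q z \<bullet> h' n z)) \<longlonglongrightarrow> indicat_real \<Omega> z *\<^sub>R (Q z \<bullet> u' z)"
      using lim by (intro always_eventually allI) (auto simp: indicator_def)
    show "AE z in lborel. norm (indicat_real \<Omega> z *\<^sub>R (Q z \<bullet> h' n z))
        \<le> (\<bar>Bu\<bar> * (\<bar>C\<bar> * 4) + \<bar>B\<bar> * \<bar>Bu'\<bar>) * indicat_real \<Omega> z" for n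
      using bound by (intro always_eventually allI) (auto simp: indicator_def)
  qed
  then show ?thesis
    using zero LIMSEQ_unique[OF _ tendsto_const] unfolding set_lebesgue_integral_def by auto
qed

section \<open>The geometry of the nozzle\<close>

lemma C1_on_interval_continuous:
  assumes "C1_on_interval a b h h'"
  shows "continuous_on {a..b} h"
  using assms by (auto simp: C1_on_interval_def intro!: DERIV_continuous_on)

lemma C1_on_interval_lipschitz:
  assumes "C1_on_interval a b h h'"
  obtains M where "0 \<le> M"
    "\<And>x y. x \<in> {a..b} \<Longrightarrow> y \<in> {a..b} \<Longrightarrow> \<bar>h x - h y\<bar> \<le> M * \<bar>x - y\<bar>"
proof -
  have "bounded (h' ` {a..b})"
    using assms by (intro compact_imp_bounded compact_continuous_image) (auto simp: C1_on_interval_def)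
  then obtain M where M: "0 < M" "\<And>x. x \<in> {a..b} \<Longrightarrow> norm (h' x) \<le> M"
    unfolding bounded_pos by auto
  show ?thesis
  proof (rule that[of M])
    fix x y assume "x \<in> {a..b}" "y \<in> {a..b}"
    then show "\<bar>h x - h y\<bar> \<le> M * \<bar>x - y\<bar>"
      using field_differentiable_bound[OF convex_real_interval(5), of a b h h' M x y] assms M
      by (auto simp: C1_on_interval_def)
  qed (use M in auto)
qed

lemma dist_Pair_le_sum: "dist (a, b) (c, d) \<le> \<bar>a - c\<bar> + \<bar>b - d\<bar>" for a b c d :: real
  by (simp add: dist_Pair_Pair dist_real_def sqrt_sum_squares_le_sum_abs)

lemma zero_on_closed_interval:
  fixes h :: "real \<Rightarrow> 'b::real_normed_vector"
  assumes "a < b" "continuous_on {a..b} h" "\<And>x. x \<in> {a<..<b} \<Longrightarrow> h x = 0" "x \<in> {a..b}"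
  shows "h x = 0"
  using continuous_constant_on_closure[of "{a<..<b}" h 0 x] assms by auto

locale nozzle =
  fixes l :: real and f f' g :: "real \<Rightarrow> real"
  assumes wall: "convergent_wall l f f'" and inlet: "inlet_curve l f g"
begin

abbreviation \<Omega> where "\<Omega> \<equiv> nozzle_domain l f g"

text \<open>
  The wall function, continued by its tangent line to the left of \<open>l\<close>, where the domain may extend if
  the inlet bulges out, and by a constant to the right of the throat. The slope at \<open>l\<close> is negative, so
  the tangent line lies above the height \<open>f l\<close> of the domain.
\<close>

definition wall_ext :: "real \<Rightarrow> real" where
  "wall_ext x = f (max l (min x 0)) + f' l * min 0 (x - l)"

definition wall_slope :: "real \<Rightarrow> real" where
  "wall_slope x = f' (max l (min x 0))"

text \<open>
  The constant continuation makes sets cut out by the inlet open or closed by continuity alone.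
\<close>

definition inlet_ext :: "real \<Rightarrow> real" where
  "inlet_ext y = g (max 0 (min (f l) y))"

lemma l_neg: "l < 0" using wall by (simp add: convergent_wall_def)
lemma wall_C1: "C1_on_interval l 0 f f'" using wall by (simp add: convergent_wall_def)
lemma f_pos: "x \<in> {l..0} \<Longrightarrow> 0 < f x" using wall by (simp add: convergent_wall_def)
lemma slope_l: "f' l < 0" using wall l_neg by (simp add: convergent_wall_def)

lemma f_antimono: "l \<le> a \<Longrightarrow> a \<le> b \<Longrightarrow> b \<le> 0 \<Longrightarrow> f b \<le> f a"
  using convergent_wall_strict_antimono[OF wall, of a b] by (cases "a = b") auto

lemma g_neg: "y \<in> {0..f l} \<Longrightarrow> g y < 0" using inlet by (simp add: inlet_curve_def)
lemma g_end: "g (f l) = l" using inlet by (simp add: inlet_curve_def)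
lemma g_wall: "0 \<le> y \<Longrightarrow> y < f l \<Longrightarrow> l \<le> g y \<Longrightarrow> y < f (g y)"
  using inlet by (simp add: inlet_curve_def)

lemma fl_pos: "0 < f l" using f_pos[of l] l_neg by simp

lemma wall_ext_left: "x \<le> l \<Longrightarrow> wall_ext x = f l + f' l * (x - l)"
  using l_neg by (simp add: wall_ext_def max_def min_def)

lemma wall_ext_eq: "l \<le> x \<Longrightarrow> x \<le> 0 \<Longrightarrow> wall_ext x = f x"
  by (simp add: wall_ext_def)

lemma wall_ext_gt_left: "x < l \<Longrightarrow> f l < wall_ext x"
  using slope_l by (simp add: wall_ext_left mult_neg_neg)

lemma continuous_wall_ext: "continuous_on A wall_ext"
  unfolding wall_ext_def[abs_def] using l_neg
  by (intro continuous_on_compose2[OF C1_on_interval_continuous[OF wall_C1], of A "\<lambda>x. max l (min x 0)"]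
      continuous_intros) auto

lemma continuous_wall_slope: "continuous_on A wall_slope"
  unfolding wall_slope_def using wall_C1 l_neg
  by (intro continuous_on_compose2[of "{l..0}" f' A "\<lambda>x. max l (min x 0)"] continuous_intros)
    (auto simp: C1_on_interval_def)

lemma continuous_inlet_ext: "continuous_on A inlet_ext"
proof -
  obtain g' where "C1_on_interval 0 (f l) g g'" using inlet by (auto simp: inlet_curve_def)
  from C1_on_interval_continuous[OF this] show ?thesis
    unfolding inlet_ext_def using fl_pos
    by (intro continuous_on_compose2[of "{0..f l}" g A "\<lambda>x. max 0 (min (f l) x)"] continuous_intros) auto
qed

text \<open>
  At \<open>l\<close> the left derivative of the tangent line and the right derivative of \<open>f\<close> coincide.
\<close>

lemma wall_ext_has_derivative:
  assumes "x < 0"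
  shows "(wall_ext has_real_derivative wall_slope x) (at x)"
proof -
  have D: "(f has_real_derivative f' x) (at x within {l..0})" if "x \<in> {l..0}" for x
    using wall_C1 that by (simp add: C1_on_interval_def)
  consider "x < l" | "x = l" | "l < x" by linarith
  then show ?thesis
  proof cases
    case 1
    have "((\<lambda>x. f l + f' l * (x - l)) has_real_derivative f' l) (at x)"
      by (auto intro!: derivative_eq_intros)
    then show ?thesis using 1 l_neg
      by (auto simp: wall_slope_def wall_ext_left wall_ext_eq
          intro: has_field_derivative_transform_within_open[of _ _ _ "{..<l}"])
  next
    case 3
    have "(f has_real_derivative f' x) (at x)"
      using D[of x] 3 assms at_within_Icc_at[of l x 0] by auto
    then show ?thesis using 3 assms
      by (auto simp: wall_slope_def wall_ext_left wall_ext_eq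
          intro: has_field_derivative_transform_within_open[of _ _ _ "{l<..<0}"])
  next
    case 2
    have fl: "wall_ext l = f l" "wall_slope l = f' l" using l_neg by (auto simp: wall_ext_eq wall_slope_def)
    have "((\<lambda>y. (wall_ext y - wall_ext l) / (y - l)) \<longlongrightarrow> f' l) (at l)"
    proof (rule filterlim_split_at)
      show "((\<lambda>y. (wall_ext y - wall_ext l) / (y - l)) \<longlongrightarrow> f' l) (at_left l)"
        by (rule tendsto_eventually, rule eventually_at_leftI[of "l - 1"])
          (auto simp: fl wall_ext_left)
      have "((\<lambda>y. (f y - f l) / (y - l)) \<longlongrightarrow> f' l) (at_right l)"
        using D[of l] l_neg at_within_Icc_at_right[of l 0] by (auto simp: has_field_derivative_iff)
      then show "((\<lambda>y. (wall_ext y - wall_ext l) / (y - l)) \<longlongrightarrow> f' l) (at_right l)"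
        by (rule Lim_transform_eventually, intro eventually_at_rightI[of l 0])
          (use l_neg in \<open>auto simp: fl wall_ext_eq\<close>)
    qed
    then show ?thesis using 2 fl by (simp add: has_field_derivative_iff)
  qed
qed

lemma inlet_ext_eq: "0 \<le> y \<Longrightarrow> y \<le> f l \<Longrightarrow> inlet_ext y = g y"
  by (simp add: inlet_ext_def)

text \<open>
  In this form the restriction \<open>l \<le> x\<close> in the wall condition disappears, since
  for \<open>x < l\<close> the continued wall is higher than \<open>f l\<close>.
\<close>

lemma mem_domain:
  "(x, y) \<in> \<Omega> \<longleftrightarrow> x < 0 \<and> 0 < y \<and> y < f l \<and> inlet_ext y < x \<and> y < wall_ext x"
  unfolding nozzle_domain_eq[OF wall inlet]
  using wall_ext_gt_left[of x] wall_ext_eq[of x] inlet_ext_eq[of y] by (cases "x < l") force+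

lemma inlet_below_wall: "0 \<le> y \<Longrightarrow> y < f l \<Longrightarrow> y < wall_ext (inlet_ext y)"
  using g_wall[of y] g_neg[of y] wall_ext_gt_left[of "g y"] wall_ext_eq[of "g y"] inlet_ext_eq[of y]
  by (cases "g y < l") auto

lemma wall_after_inlet: "l < x \<Longrightarrow> x \<le> 0 \<Longrightarrow> inlet_ext (f x) < x"
  using g_wall[of "f x"] f_pos[of x] convergent_wall_strict_antimono[OF wall, of l x]
    f_antimono[of x "g (f x)"] g_neg[of "f x"] inlet_ext_eq[of "f x"]
  by (cases "g (f x) < x") auto

lemma open_domain: "open \<Omega>"
proof -
  have "\<Omega> = {z. fst z < 0 \<and> 0 < snd z \<and> snd z < f l \<and> inlet_ext (snd z) < fst z \<and> snd z < wall_ext (fst z)}"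
    using mem_domain by auto
  also have "open \<dots>"
    by (intro open_Collect_conj open_Collect_less continuous_intros
        continuous_on_compose2[OF continuous_inlet_ext[of UNIV]] continuous_on_compose2[OF continuous_wall_ext[of UNIV]]) auto
  finally show ?thesis .
qed

lemma closure_domain:
  assumes "(x, y) \<in> closure \<Omega>"
  shows "x \<le> 0" "0 \<le> y" "y \<le> f l" "inlet_ext y \<le> x" "y \<le> wall_ext x"
proof -
  let ?W = "{z. fst z \<le> 0 \<and> 0 \<le> snd z \<and> snd z \<le> f l \<and> inlet_ext (snd z) \<le> fst z \<and> snd z \<le> wall_ext (fst z)}"
  have "closed ?W"
    by (intro closed_Collect_conj closed_Collect_le continuous_intros
        continuous_on_compose2[OF continuous_inlet_ext[of UNIV]] continuous_on_compose2[OF continuous_wall_ext[of UNIV]]) auto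
  moreover have "\<Omega> \<subseteq> ?W" using mem_domain by auto
  ultimately have "closure \<Omega> \<subseteq> ?W" by (rule closure_minimal[rotated])
  then show "x \<le> 0" "0 \<le> y" "y \<le> f l" "inlet_ext y \<le> x" "y \<le> wall_ext x"
    using assms by auto
qed

lemma bounded_domain: "bounded \<Omega>"
proof -
  have "bounded (inlet_ext ` {0..f l})"
    by (intro compact_imp_bounded compact_continuous_image continuous_inlet_ext) auto
  then obtain B where B: "\<And>y. y \<in> {0..f l} \<Longrightarrow> \<bar>inlet_ext y\<bar> \<le> B"
    unfolding bounded_iff by (metis imageI real_norm_def)
  have "\<Omega> \<subseteq> {-B..0} \<times> {0..f l}"
  proof
    fix z assume "z \<in> \<Omega>"
    then show "z \<in> {-B..0} \<times> {0..f l}"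
      using mem_domain[of "fst z" "snd z"] B[of "snd z"] by (cases z) auto
  qed
  then show ?thesis by (rule bounded_subset[rotated]) (intro bounded_Times bounded_closed_interval)
qed

lemma compact_closure_domain: "compact (closure \<Omega>)"
  using bounded_domain by (simp add: compact_closure)

lemma closure_limit:
  assumes "(p \<longlongrightarrow> z) (at_right (0::real))" "eventually (\<lambda>s. p s \<in> \<Omega>) (at_right 0)"
  shows "z \<in> closure \<Omega>"
  using assms closure_subset[of \<Omega>]
  by (intro Lim_in_closed_set[of "closure \<Omega>" p "at_right 0"]) (auto elim: eventually_mono)

lemma throat_in_closure: "(\<lambda>t. (0, t)) ` {0..f 0} \<subseteq> closure \<Omega>"
proof -
  have f0: "0 < f 0" "f 0 \<le> f l" using f_pos[of 0] f_antimono[of l 0] l_neg by auto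
  have "(0, t) \<in> closure \<Omega>" if t: "t \<in> {0<..<f 0}" for t
  proof (rule closure_limit)
    show "((\<lambda>s. (- s, t)) \<longlongrightarrow> (0, t)) (at_right (0::real))" by (auto intro!: tendsto_eq_intros)
    have t': "0 < t" "t < f l" using t f0 by auto
    have "((\<lambda>s. wall_ext (- s)) \<longlongrightarrow> wall_ext (- 0)) (at_right 0)"
      by (rule isCont_tendsto_compose[OF _ tendsto_minus[OF tendsto_ident_at]])
        (auto intro: continuous_on_interior[OF continuous_wall_ext[of UNIV]])
    then have "\<forall>\<^sub>F s in at_right 0. t < wall_ext (- s)"
      using t l_neg wall_ext_eq[of 0] by (intro order_tendstoD) auto
    moreover have "\<forall>\<^sub>F s in at_right 0. inlet_ext t < - s"
      using t' g_neg[of t] inlet_ext_eq[of t]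
      by (intro order_tendstoD(1)[OF tendsto_minus[OF tendsto_ident_at]]) simp
    moreover have "\<forall>\<^sub>F s in at_right (0::real). 0 < s" by (rule eventually_at_right_less)
    ultimately show "\<forall>\<^sub>F s in at_right 0. (- s, t) \<in> \<Omega>"
      by eventually_elim (use t' in \<open>auto simp: mem_domain\<close>)
  qed
  then have "(\<lambda>t. (0, t)) ` closure {0<..<f 0} \<subseteq> closure \<Omega>"
    by (intro image_closure_subset continuous_intros closed_closure) auto
  then show ?thesis using f0 by simp
qed

lemma axis_in_closure: "(\<lambda>x. (x, 0)) ` {g 0..0} \<subseteq> closure \<Omega>"
proof -
  have g0: "g 0 < 0" using g_neg[of 0] fl_pos by simp
  have "(x, 0) \<in> closure \<Omega>" if x: "x \<in> {g 0<..<0}" for x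
  proof (rule closure_limit)
    show "((\<lambda>s. (x, s)) \<longlongrightarrow> (x, 0)) (at_right 0)" by (auto intro!: tendsto_eq_intros)
    have "(inlet_ext \<longlongrightarrow> inlet_ext 0) (at_right 0)"
      using continuous_inlet_ext[of UNIV] by (auto simp: continuous_on_def intro: tendsto_within_subset)
    then have "\<forall>\<^sub>F s in at_right 0. inlet_ext s < x"
      using x fl_pos inlet_ext_eq[of 0] by (intro order_tendstoD) auto
    moreover have "0 < wall_ext x"
      using x f_pos[of x] wall_ext_gt_left[of x] wall_ext_eq[of x] fl_pos by (cases "x < l") auto
    then have "\<forall>\<^sub>F s in at_right 0. s < wall_ext x" "\<forall>\<^sub>F s in at_right 0. s < f l"
      using fl_pos by (auto intro!: order_tendstoD(2)[OF tendsto_ident_at])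
    moreover have "\<forall>\<^sub>F s in at_right (0::real). 0 < s" by (rule eventually_at_right_less)
    ultimately show "\<forall>\<^sub>F s in at_right 0. (x, s) \<in> \<Omega>"
      by eventually_elim (use x in \<open>auto simp: mem_domain\<close>)
  qed
  then have "(\<lambda>x. (x, 0)) ` closure {g 0<..<0} \<subseteq> closure \<Omega>"
    by (intro image_closure_subset continuous_intros closed_closure) auto
  then show ?thesis using g0 by simp
qed

lemma wall_in_closure: "(\<lambda>x. (x, f x)) ` {l..0} \<subseteq> closure \<Omega>"
proof -
  have "(x, f x) \<in> closure \<Omega>" if x: "x \<in> {l<..<0}" for x
  proof (rule closure_limit)
    show "((\<lambda>s. (x, f x - s)) \<longlongrightarrow> (x, f x)) (at_right 0)" by (auto intro!: tendsto_eq_intros)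
    have "((\<lambda>s. inlet_ext (f x - s)) \<longlongrightarrow> inlet_ext (f x - 0)) (at_right 0)"
      by (rule isCont_tendsto_compose[of _ inlet_ext])
        (auto intro!: tendsto_eq_intros continuous_on_interior[OF continuous_inlet_ext[of UNIV]])
    then have "\<forall>\<^sub>F s in at_right 0. inlet_ext (f x - s) < x"
      using x wall_after_inlet[of x] by (intro order_tendstoD) auto
    moreover have "\<forall>\<^sub>F s in at_right 0. s < f x"
      using f_pos[of x] x by (auto intro!: order_tendstoD(2)[OF tendsto_ident_at])
    moreover have "\<forall>\<^sub>F s in at_right (0::real). 0 < s" by (rule eventually_at_right_less)
    ultimately show "\<forall>\<^sub>F s in at_right 0. (x, f x - s) \<in> \<Omega>"
      by eventually_elim (use x f_antimono[of l x] in \<open>auto simp: mem_domain wall_ext_eq\<close>)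
  qed
  then have "(\<lambda>x. (x, f x)) ` closure {l<..<0} \<subseteq> closure \<Omega>"
    using l_neg by (intro image_closure_subset continuous_intros closed_closure)
      (auto intro: C1_on_interval_continuous[OF wall_C1])
  then show ?thesis using l_neg by simp
qed

lemma inlet_in_closure: "(\<lambda>y. (g y, y)) ` {0..f l} \<subseteq> closure \<Omega>"
proof -
  have "(inlet_ext y, y) \<in> closure \<Omega>" if y: "y \<in> {0<..<f l}" for y
  proof (rule closure_limit)
    show "((\<lambda>s. (inlet_ext y + s, y)) \<longlongrightarrow> (inlet_ext y, y)) (at_right 0)" by (auto intro!: tendsto_eq_intros)
    have "((\<lambda>s. wall_ext (inlet_ext y + s)) \<longlongrightarrow> wall_ext (inlet_ext y + 0)) (at_right 0)"
      by (rule isCont_tendsto_compose[of _ wall_ext])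
        (auto intro!: tendsto_eq_intros continuous_on_interior[OF continuous_wall_ext[of UNIV]])
    then have "\<forall>\<^sub>F s in at_right 0. y < wall_ext (inlet_ext y + s)"
      using y inlet_below_wall[of y] by (intro order_tendstoD) auto
    moreover have "inlet_ext y < 0" using y g_neg[of y] inlet_ext_eq[of y] by auto
    then have "\<forall>\<^sub>F s in at_right 0. inlet_ext y + s < 0"
      
      by (intro order_tendstoD(2)[OF tendsto_add[OF tendsto_const tendsto_ident_at]]) simp
    moreover have "\<forall>\<^sub>F s in at_right (0::real). 0 < s" by (rule eventually_at_right_less)
    ultimately show "\<forall>\<^sub>F s in at_right 0. (inlet_ext y + s, y) \<in> \<Omega>"
      by eventually_elim (use y in \<open>auto simp: mem_domain\<close>)
  qed
  then have "(\<lambda>y. (inlet_ext y, y)) ` closure {0<..<f l} \<subseteq> closure \<Omega>"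
    by (intro image_closure_subset continuous_intros closed_closure continuous_inlet_ext) auto
  then show ?thesis using fl_pos inlet_ext_eq by force
qed

text \<open>
  The following three lemmas provide, for every point of the domain, a point of the throat, the axis
  or the wall whose distance is controlled by the corresponding factor of the weight. The point
  straight across may lie outside of that boundary piece; then its end point is taken, and the
  Lipschitz continuity of the adjacent boundary curve bounds the distance to it.
\<close>

lemma throat_near:
  obtains K where "0 \<le> K" "\<And>x y. (x, y) \<in> \<Omega> \<Longrightarrow> \<exists>t\<in>{0..f 0}. dist (x, y) (0, t) \<le> K * - x"
proof -
  obtain M where M: "0 \<le> M" "\<And>x y. x \<in> {l..0} \<Longrightarrow> y \<in> {l..0} \<Longrightarrow> \<bar>f x - f y\<bar> \<le> M * \<bar>x - y\<bar>"
    using C1_on_interval_lipschitz[OF wall_C1] by blast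
  show ?thesis
  proof (rule that[of "1 + M"])
    fix x y assume "(x, y) \<in> \<Omega>"
    then have xy: "x < 0" "0 < y" "y < f l" "y < wall_ext x" by (auto simp: mem_domain)
    have "y - f 0 \<le> M * - x"
    proof -
      have "y \<le> f (max l x)" using xy wall_ext_eq[of x] by (cases "x < l") auto
      then have "y - f 0 \<le> M * \<bar>max l x - 0\<bar>" using M(2)[of "max l x" 0] xy l_neg by auto
      also have "\<dots> \<le> M * - x" using M(1) xy l_neg by (intro mult_left_mono) auto
      finally show ?thesis .
    qed
    then have "dist (x, y) (0, min y (f 0)) \<le> (1 + M) * - x"
      using xy M(1) by (intro order_trans[OF dist_Pair_le_sum])
        (auto simp: algebra_simps min_def mult_nonneg_nonpos)
    then show "\<exists>t\<in>{0..f 0}. dist (x, y) (0, t) \<le> (1 + M) * - x"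
      using xy f_pos[of 0] l_neg by (intro bexI[of _ "min y (f 0)"]) auto
  qed (use M in simp)
qed

text \<open>
  For points of the domain with \<open>x < g 0\<close>, which exist if the inlet bends to the left, the nearby
  point is \<open>(g 0, 0)\<close>.
\<close>

lemma axis_near:
  obtains K where "0 \<le> K" "\<And>x y. (x, y) \<in> \<Omega> \<Longrightarrow> \<exists>s\<in>{g 0..0}. dist (x, y) (s, 0) \<le> K * y"
proof -
  obtain g' where "C1_on_interval 0 (f l) g g'" using inlet by (auto simp: inlet_curve_def)
  then obtain M where M: "0 \<le> M" "\<And>x y. x \<in> {0..f l} \<Longrightarrow> y \<in> {0..f l} \<Longrightarrow> \<bar>g x - g y\<bar> \<le> M * \<bar>x - y\<bar>"
    using C1_on_interval_lipschitz by blast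
  show ?thesis
  proof (rule that[of "1 + M"])
    fix x y assume "(x, y) \<in> \<Omega>"
    then have xy: "x < 0" "0 < y" "y < f l" "g y < x" by (auto simp: mem_domain inlet_ext_eq)
    have "g 0 - x \<le> M * y" using M(2)[of 0 y] xy by auto
    then have "dist (x, y) (max x (g 0), 0) \<le> (1 + M) * y"
      using xy M(1) by (intro order_trans[OF dist_Pair_le_sum]) (auto simp: algebra_simps max_def)
    then show "\<exists>s\<in>{g 0..0}. dist (x, y) (s, 0) \<le> (1 + M) * y"
      using xy g_neg[of 0] by (intro bexI[of _ "max x (g 0)"]) auto
  qed (use M in simp)
qed

text \<open>
  To the left of \<open>l\<close> the nearby point is \<open>(l, f l)\<close>. There
  \<open>wall_ext x - y = (f l - y) + (- f' l) * (l - x)\<close> has two nonnegative summands, and it controls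
  both coordinates of the difference because \<open>f' l \<noteq> 0\<close>.
\<close>

lemma wall_near:
  obtains K where "0 \<le> K"
    "\<And>x y. (x, y) \<in> \<Omega> \<Longrightarrow> \<exists>s\<in>{l..0}. wall_slope x = f' s \<and> dist (x, y) (s, f s) \<le> K * (wall_ext x - y)"
proof (rule that[of "1 + 1 / - f' l"])
  show "0 \<le> 1 + 1 / - f' l" using slope_l by (intro add_nonneg_nonneg divide_nonneg_nonneg) auto
  fix x y assume "(x, y) \<in> \<Omega>"
  then have xy: "x < 0" "0 < y" "y < f l" "y < wall_ext x" by (auto simp: mem_domain)
  have "dist (x, y) (max l x, f (max l x)) \<le> (1 + 1 / - f' l) * (wall_ext x - y)"
  proof (cases "x < l")
    case True
    have w: "wall_ext x - y = (f l - y) + - f' l * (l - x)" using True by (simp add: wall_ext_left algebra_simps)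
    have "- f' l * (l - x) \<le> wall_ext x - y" unfolding w using xy by simp
    then have 1: "l - x \<le> 1 / - f' l * (wall_ext x - y)" using slope_l by (simp add: field_simps)
    have 2: "f l - y \<le> wall_ext x - y" unfolding w using slope_l True by (simp add: mult_nonpos_nonneg)
    have "dist (x, y) (max l x, f (max l x)) \<le> (l - x) + (f l - y)"
      using True xy by (intro order_trans[OF dist_Pair_le_sum]) (auto simp: max_def)
    also have "\<dots> \<le> (1 + 1 / - f' l) * (wall_ext x - y)" using add_mono[OF 1 2] by (simp only: distrib_right mult_1 add.commute)
    finally show ?thesis .
  next
    case False
    then have "dist (x, y) (max l x, f (max l x)) \<le> 1 * (wall_ext x - y)"
      using xy wall_ext_eq[of x] by (intro order_trans[OF dist_Pair_le_sum]) (auto simp: max_def)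
    also have "\<dots> \<le> (1 + 1 / - f' l) * (wall_ext x - y)"
      using xy slope_l by (intro mult_right_mono) auto
    finally show ?thesis .
  qed
  then show "\<exists>s\<in>{l..0}. wall_slope x = f' s \<and> dist (x, y) (s, f s) \<le> (1 + 1 / - f' l) * (wall_ext x - y)"
    using xy l_neg by (intro bexI[of _ "max l x"]) (auto simp: wall_slope_def min_def)
qed

section \<open>A weight that vanishes on the impermeable boundary\<close>

text \<open>
  The product of the distances to the throat, to the axis, and (vertically) to the continued wall. It
  is positive in the domain and vanishes on the throat, the axis and the wall.
\<close>

definition weight :: "real \<times> real \<Rightarrow> real" where
  "weight z = - fst z * snd z * (wall_ext (fst z) - snd z)"

definition weight_grad :: "real \<times> real \<Rightarrow> real \<times> real" where
  "weight_grad z =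
     (- (snd z * (wall_ext (fst z) - snd z)) - fst z * snd z * wall_slope (fst z),
      - fst z * (wall_ext (fst z) - snd z) + fst z * snd z)"

lemma weight_GDERIV:
  assumes "z \<in> \<Omega>"
  shows "GDERIV weight z :> weight_grad z"
proof -
  obtain x y where z: "z = (x, y)" by (cases z)
  have "x < 0" using assms z mem_domain by auto
  have f: "GDERIV fst z :> (1, 0)" and s: "GDERIV snd z :> (0, 1)"
    by (auto simp: gderiv_def inner_prod_def intro!: derivative_eq_intros)
  have w: "GDERIV (\<lambda>z. wall_ext (fst z)) z :> wall_slope (fst z) *\<^sub>R (1, 0)"
    using wall_ext_has_derivative[OF \<open>x < 0\<close>] by (intro GDERIV_DERIV_compose f) (simp add: z)
  show ?thesis
    unfolding weight_def[abs_def]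
    by (rule GDERIV_subst[OF GDERIV_mult[OF GDERIV_mult[OF GDERIV_minus[OF f] s] GDERIV_diff[OF w s]]])
      (simp add: weight_grad_def algebra_simps)
qed

lemma continuous_weight: "continuous_on A weight" and continuous_weight_grad: "continuous_on A weight_grad"
proof -
  have "continuous_on A (\<lambda>z :: real \<times> real. wall_ext (fst z))" "continuous_on A (\<lambda>z :: real \<times> real. wall_slope (fst z))"
    by (auto intro!: continuous_on_compose2[OF continuous_wall_ext[of UNIV]]
        continuous_on_compose2[OF continuous_wall_slope[of UNIV]] continuous_intros)
  then show "continuous_on A weight" "continuous_on A weight_grad"
    by (auto simp: weight_def[abs_def] weight_grad_def[abs_def] intro!: continuous_intros)
qed

lemma weight_pos: "z \<in> \<Omega> \<Longrightarrow> 0 < weight z"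
  by (cases z) (auto simp: weight_def mem_domain mult_neg_pos)

text \<open>
  Superlevel sets of the weight reach the boundary of the domain only in the inlet.
\<close>

lemma closure_off_boundary:
  assumes "z \<in> closure \<Omega>" "0 < weight z" "fst z \<noteq> g (snd z)"
  shows "z \<in> \<Omega>"
proof -
  obtain x y where z: "z = (x, y)" by (cases z)
  note c = closure_domain[OF assms(1)[unfolded z]]
  have p: "x < 0" "0 < y" "y < wall_ext x"
    using c assms(2) by (auto simp: weight_def z less_le)
  have "inlet_ext y \<noteq> x" using assms(3) c by (auto simp: z inlet_ext_eq)
  moreover have "y < f l"
  proof (rule ccontr)
    assume "\<not> y < f l"
    then have "y = f l" using c by simp
    then have "l \<le> x" using c g_end fl_pos by (simp add: inlet_ext_eq)
    then show False using p \<open>y = f l\<close> f_antimono[of l x] by (simp add: wall_ext_eq)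
  qed
  ultimately show ?thesis using c p by (simp add: z mem_domain)
qed

text \<open>
  Each of the three terms of \<open>Q \<bullet> \<nabla>weight\<close> lacks one factor of the weight. The missing factor is
  recovered from a component of \<open>Q\<close> that vanishes on the corresponding boundary piece: the
  first component on the throat, the second one on the axis, and \<open>f' Q\<^sub>1 - Q\<^sub>2\<close> on the wall. For the
  last one it matters that the slope is taken at the same abscissa at both points, because \<open>f'\<close> is
  only continuous.
\<close>

lemma weight_flux_bound:
  fixes Q :: "real \<times> real \<Rightarrow> real \<times> real"
  assumes L: "L-lipschitz_on (closure \<Omega>) Q"
    and throat: "\<And>y. y \<in> {0<..<f 0} \<Longrightarrow> Q (0, y) = 0"
    and axis: "\<And>x. x \<in> {g 0<..<0} \<Longrightarrow> snd (Q (x, 0)) = 0"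
    and wall': "\<And>x. x \<in> {l<..<0} \<Longrightarrow> snd (Q (x, f x)) - f' x * fst (Q (x, f x)) = 0"
  shows "\<exists>C. \<forall>z\<in>\<Omega>. \<bar>Q z \<bullet> weight_grad z\<bar> \<le> C * weight z"
proof -
  have Qc: "continuous_on (closure \<Omega>) Q" by (rule lipschitz_on_continuous_on[OF L])
  have L0: "0 \<le> L" by (rule lipschitz_on_nonneg[OF L])
  have lip: "norm (Q z - Q w) \<le> L * dist z w" if "z \<in> \<Omega>" "w \<in> closure \<Omega>" for z w
    using lipschitz_onD[OF L, of z w] that closure_subset[of \<Omega>] by (auto simp: dist_norm)
  have throat0: "Q (0, y) = 0" if "y \<in> {0..f 0}" for y
    by (rule zero_on_closed_interval[OF _ _ throat that])
      (use f_pos[of 0] l_neg throat_in_closure in \<open>auto intro!: continuous_on_compose2[OF Qc] continuous_intros\<close>)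
  have axis0: "snd (Q (x, 0)) = 0" if "x \<in> {g 0..0}" for x
    by (rule zero_on_closed_interval[OF _ _ axis that])
      (use g_neg[of 0] fl_pos axis_in_closure in \<open>auto intro!: continuous_on_compose2[OF Qc] continuous_intros\<close>)
  \<comment> \<open>The end point l matters: it stands in for the continued wall to the left of l.\<close>
  have wall0: "snd (Q (x, f x)) - f' x * fst (Q (x, f x)) = 0" if "x \<in> {l..0}" for x
  proof (rule zero_on_closed_interval[OF l_neg _ wall' that])
    have "continuous_on {l..0} (\<lambda>x. Q (x, f x))"
      by (rule continuous_on_compose2[OF Qc])
        (use wall_in_closure in \<open>auto intro!: continuous_intros C1_on_interval_continuous[OF wall_C1]\<close>)
    moreover have "continuous_on {l..0} f'" using wall_C1 by (simp add: C1_on_interval_def)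
    ultimately show "continuous_on {l..0} (\<lambda>x. snd (Q (x, f x)) - f' x * fst (Q (x, f x)))"
      by (intro continuous_intros)
  qed
  obtain K1 where K1: "0 \<le> K1" "\<And>x y. (x, y) \<in> \<Omega> \<Longrightarrow> \<exists>t\<in>{0..f 0}. dist (x, y) (0, t) \<le> K1 * - x"
    using throat_near by blast
  obtain K2 where K2: "0 \<le> K2" "\<And>x y. (x, y) \<in> \<Omega> \<Longrightarrow> \<exists>s\<in>{g 0..0}. dist (x, y) (s, 0) \<le> K2 * y"
    using axis_near by blast
  obtain K3 where K3: "0 \<le> K3" "\<And>x y. (x, y) \<in> \<Omega> \<Longrightarrow>
      \<exists>s\<in>{l..0}. wall_slope x = f' s \<and> dist (x, y) (s, f s) \<le> K3 * (wall_ext x - y)"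
    using wall_near by blast
  have "bounded (f' ` {l..0})"
    using wall_C1 by (intro compact_imp_bounded compact_continuous_image) (auto simp: C1_on_interval_def)
  then obtain M where M: "0 < M" "\<And>x. x \<in> {l..0} \<Longrightarrow> \<bar>f' x\<bar> \<le> M"
    unfolding bounded_pos by auto
  show ?thesis
  proof (intro exI[of _ "L * K1 + L * K2 + (1 + M) * (L * K3)"] ballI)
    fix z assume z: "z \<in> \<Omega>"
    obtain x y where xy: "z = (x, y)" by (cases z)
    define a b G where "a = fst (Q z)" and "b = snd (Q z)" and "G = wall_ext x - y"
    have pos: "0 < - x" "0 < y" "0 < G" using z by (auto simp: xy mem_domain G_def)
    have A: "\<bar>a\<bar> \<le> L * K1 * - x"
    proof -
      obtain t where t: "t \<in> {0..f 0}" "dist (x, y) (0, t) \<le> K1 * - x" using K1(2) z xy by blast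
      have "norm (Q z - Q (0, t)) \<le> L * dist z (0, t)" using throat_in_closure t by (intro lip z) auto
      also have "\<dots> \<le> L * (K1 * - x)" using t L0 xy by (intro mult_left_mono) auto
      finally show ?thesis using norm_fst_le[of "fst (Q z)" "snd (Q z)"] throat0[OF t(1)] by (simp add: a_def)
    qed
    have B: "\<bar>b\<bar> \<le> L * K2 * y"
    proof -
      obtain s where s: "s \<in> {g 0..0}" "dist (x, y) (s, 0) \<le> K2 * y" using K2(2) z xy by blast
      have "norm (Q z - Q (s, 0)) \<le> L * dist z (s, 0)" using axis_in_closure s by (intro lip z) auto
      also have "\<dots> \<le> L * (K2 * y)" using s L0 xy by (intro mult_left_mono) auto
      finally show ?thesis
        using norm_snd_le[of "snd (Q z - Q (s, 0))" "fst (Q z - Q (s, 0))"] axis0[OF s(1)]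
        unfolding prod.collapse by (simp add: b_def)
    qed
    have W: "\<bar>wall_slope x * a - b\<bar> \<le> (1 + M) * (L * K3) * G"
    proof -
      obtain s where s: "s \<in> {l..0}" "wall_slope x = f' s" "dist (x, y) (s, f s) \<le> K3 * G"
        using K3(2)[of x y] z xy unfolding G_def by blast
      define d where "d = Q z - Q (s, f s)"
      have "norm d \<le> L * dist z (s, f s)" unfolding d_def using wall_in_closure s by (intro lip z) auto
      also have "\<dots> \<le> L * (K3 * G)" using s L0 xy by (intro mult_left_mono) auto
      finally have d: "norm d \<le> L * (K3 * G)" .
      have "wall_slope x * a - b = f' s * fst d - snd d"
        using wall0[OF s(1)] by (simp add: s(2) d_def a_def b_def algebra_simps)
      also have "\<bar>\<dots>\<bar> \<le> \<bar>f' s\<bar> * \<bar>fst d\<bar> + \<bar>snd d\<bar>" by (simp add: abs_mult[symmetric])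
      also have "\<dots> \<le> M * norm d + norm d"
        using M(1) M(2)[OF s(1)] norm_fst_le[of "fst d" "snd d"] norm_snd_le[of "snd d" "fst d"]
        by (intro add_mono mult_mono) auto
      also have "\<dots> = (1 + M) * norm d" by (simp add: algebra_simps)
      also have "\<dots> \<le> (1 + M) * (L * (K3 * G))" using d M(1) by (intro mult_left_mono) auto
      finally show ?thesis by (simp add: mult_ac)
    qed
    have "Q z \<bullet> weight_grad z = - a * (y * G) + (- x) * G * b + (- x) * y * (wall_slope x * a - b)"
      by (simp add: inner_prod_def weight_grad_def xy a_def b_def G_def algebra_simps)
    also have "\<bar>\<dots>\<bar> \<le> \<bar>a\<bar> * (y * G) + (- x) * G * \<bar>b\<bar> + (- x) * y * \<bar>wall_slope x * a - b\<bar>"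
      using pos by (intro order_trans[OF abs_triangle_ineq] add_mono) (auto simp: abs_mult)
    also have "\<dots> \<le> (L * K1 * - x) * (y * G) + (- x) * G * (L * K2 * y)
        + (- x) * y * ((1 + M) * (L * K3) * G)"
      using A B W pos by (intro add_mono mult_mono mult_left_mono) (auto intro: mult_nonpos_nonneg)
    also have "\<dots> = (L * K1 + L * K2 + (1 + M) * (L * K3)) * weight z"
      by (simp add: weight_def xy G_def algebra_simps)
    finally show "\<bar>Q z \<bullet> weight_grad z\<bar> \<le> (L * K1 + L * K2 + (1 + M) * (L * K3)) * weight z" .
  qed
qed

end

section \<open>Uniqueness\<close>

lemma GDERIV_imp_partials:
  assumes "GDERIV \<phi> (x, y) :> d"
  shows "((\<lambda>s. \<phi> (s, y)) has_real_derivative fst d) (at x)"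
    and "((\<lambda>s. \<phi> (x, s)) has_real_derivative snd d) (at y)"
proof -
  have D: "(\<phi> has_derivative (\<lambda>h. h \<bullet> d)) (at (x, y))" using assms by (simp add: gderiv_def)
  have "((\<lambda>s. (s, y)) has_derivative (\<lambda>h. (h, 0))) (at x)"
    by (auto intro!: derivative_eq_intros)
  from has_derivative_compose[OF this D] show "((\<lambda>s. \<phi> (s, y)) has_real_derivative fst d) (at x)"
    by (simp add: has_field_derivative_def inner_prod_def mult_commute_abs)
  have "((\<lambda>s. (x, s)) has_derivative (\<lambda>h. (0, h))) (at y)"
    by (auto intro!: derivative_eq_intros)
  from has_derivative_compose[OF this D] show "((\<lambda>s. \<phi> (x, s)) has_real_derivative snd d) (at y)"
    by (simp add: has_field_derivative_def inner_prod_def mult_commute_abs)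
qed

context nozzle
begin

text \<open>
  The gradient \<open>v\<close> on the throat is a limit of gradients from inside, so its relation to the values of
  \<open>\<phi>\<close> on the throat needs an argument. By the mean value theorem on short vertical segments
  inside the domain, \<open>\<phi>(x, s) - \<phi>(x, t)\<close> is \<open>(s - t) v\<^sub>2(0, t)\<close> up to an error
  \<open>L (s - t) (\<bar>x\<bar> + (s - t))\<close>. Letting \<open>x\<close> tend to zero and then \<open>s\<close> to \<open>t\<close> gives the claim.
\<close>

lemma throat_tangential:
  assumes \<phi>: "C11_closure \<Omega> \<phi> v" and zero: "\<And>y. y \<in> {0<..<f 0} \<Longrightarrow> \<phi> (0, y) = 0"
    and t: "t \<in> {0<..<f 0}"
  shows "snd (v (0, t)) = 0"
proof -
  obtain L where L: "L-lipschitz_on (closure \<Omega>) v" using \<phi> by (auto simp: C11_closure_def)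
  have L0: "0 \<le> L" by (rule lipschitz_on_nonneg[OF L])
  have \<phi>c: "continuous_on (closure \<Omega>) \<phi>" and D: "\<And>z. z \<in> \<Omega> \<Longrightarrow> GDERIV \<phi> z :> v z"
    using \<phi> by (auto simp: C11_closure_def)
  have f0: "f 0 \<le> f l" using f_antimono[of l 0] l_neg by simp
  define b where "b = snd (v (0, t))"
  have bound: "\<bar>b\<bar> \<le> L * (s - t)" if s: "t < s" "s < f 0" for s
  proof -
    have seg: "\<forall>\<^sub>F x in at_left 0. \<forall>y\<in>{t..s}. (x, y) \<in> \<Omega>"
    proof -
      obtain y0 where y0: "y0 \<in> {t..s}" "\<And>y. y \<in> {t..s} \<Longrightarrow> inlet_ext y \<le> inlet_ext y0"
        using continuous_attains_sup[of "{t..s}" inlet_ext] continuous_inlet_ext s by auto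
      have "inlet_ext y0 < 0" using y0(1) s t f0 g_neg[of y0] by (auto simp: inlet_ext_eq)
      then have "\<forall>\<^sub>F x in at_left 0. x \<in> {max l (inlet_ext y0)<..<0}"
        using l_neg by (intro eventually_at_leftI[of "max l (inlet_ext y0)"]) auto
      then show ?thesis
      proof eventually_elim
        case (elim x)
        show ?case
        proof
          fix y assume y: "y \<in> {t..s}"
          have "f 0 \<le> f x" using elim by (intro f_antimono) auto
          then show "(x, y) \<in> \<Omega>"
            using elim y y0(2)[OF y] s t f0 by (auto simp: mem_domain wall_ext_eq)
        qed
      qed
    qed
    have ev: "\<forall>\<^sub>F x in at_left 0. \<bar>\<phi> (x, s) - \<phi> (x, t) - (s - t) * b\<bar> \<le> (s - t) * (L * (\<bar>x\<bar> + (s - t)))"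
      using seg
    proof eventually_elim
      case (elim x)
      then obtain \<xi> where \<xi>: "t < \<xi>" "\<xi> < s" "\<phi> (x, s) - \<phi> (x, t) = (s - t) * snd (v (x, \<xi>))"
        using MVT2[OF s(1), of "\<lambda>y. \<phi> (x, y)" "\<lambda>y. snd (v (x, y))"] GDERIV_imp_partials(2)[OF D] by auto
      have "\<bar>snd (v (x, \<xi>)) - b\<bar> \<le> norm (v (x, \<xi>) - v (0, t))"
        using norm_snd_le[of "snd (v (x, \<xi>) - v (0, t))" "fst (v (x, \<xi>) - v (0, t))"]
        unfolding prod.collapse by (simp add: b_def)
      also have "\<dots> \<le> L * dist (x, \<xi>) (0, t)"
        using lipschitz_onD[OF L, of "(x, \<xi>)" "(0, t)"] elim \<xi> t throat_in_closure closure_subset[of \<Omega>]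
        by (auto simp: dist_norm image_subset_iff subset_iff)
      also have "\<dots> \<le> L * (\<bar>x\<bar> + (s - t))"
        using dist_Pair_le_sum[of x \<xi> 0 t] \<xi> L0 by (intro mult_left_mono) auto
      finally have "(s - t) * \<bar>snd (v (x, \<xi>)) - b\<bar> \<le> (s - t) * (L * (\<bar>x\<bar> + (s - t)))"
        using s by (intro mult_left_mono) auto
      moreover have "\<phi> (x, s) - \<phi> (x, t) - (s - t) * b = (s - t) * (snd (v (x, \<xi>)) - b)"
        using \<xi>(3) by (simp add: algebra_simps)
      ultimately show ?case using s by (simp add: abs_mult)
    qed
    have lim: "((\<lambda>x. \<phi> (x, y)) \<longlongrightarrow> 0) (at_left 0)" if y: "y \<in> {t..s}" for y
    proof -
      have "((\<lambda>x. \<phi> (x, y)) \<longlongrightarrow> \<phi> (0, y)) (at_left 0)"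
      proof (rule continuous_on_tendsto_compose[OF \<phi>c])
        show "((\<lambda>x. (x, y)) \<longlongrightarrow> (0, y)) (at_left 0)" by (auto intro!: tendsto_eq_intros)
        show "(0, y) \<in> closure \<Omega>" using y s t throat_in_closure by auto
        show "\<forall>\<^sub>F x in at_left 0. (x, y) \<in> closure \<Omega>"
          using seg by eventually_elim (use y closure_subset[of \<Omega>] in auto)
      qed
      then show ?thesis using zero[of y] y s t by simp
    qed
    have "((\<lambda>x. \<bar>\<phi> (x, s) - \<phi> (x, t) - (s - t) * b\<bar>) \<longlongrightarrow> \<bar>0 - 0 - (s - t) * b\<bar>) (at_left 0)"
      by (intro tendsto_intros lim) (use s in auto)
    moreover have "((\<lambda>x. (s - t) * (L * (\<bar>x\<bar> + (s - t)))) \<longlongrightarrow> (s - t) * (L * (\<bar>0\<bar> + (s - t)))) (at_left 0)"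
      by (intro tendsto_intros)
    ultimately have "\<bar>0 - 0 - (s - t) * b\<bar> \<le> (s - t) * (L * (\<bar>0\<bar> + (s - t)))"
      by (intro tendsto_le[OF _ _ _ ev]) auto
    then show ?thesis using s by (simp add: abs_mult)
  qed
  have "\<bar>b\<bar> \<le> L * (t - t)"
  proof (rule tendsto_lowerbound[of "\<lambda>s. L * (s - t)" _ "at_right t"])
    show "((\<lambda>s. L * (s - t)) \<longlongrightarrow> L * (t - t)) (at_right t)" by (intro tendsto_intros)
    show "\<forall>\<^sub>F s in at_right t. \<bar>b\<bar> \<le> L * (s - t)"
      using t bound by (intro eventually_at_rightI[of t "f 0"]) auto
  qed auto
  then show ?thesis by (simp add: b_def)
qed

text \<open>
  The speed on the throat is \<open>c\<^sub>*\<close> and the tangential component vanishes, so the horizontal component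
  is a continuous function with values in \<open>{c\<^sub>*, -c\<^sub>*}\<close> on an interval.
\<close>

lemma throat_velocity:
  assumes s: "subsonic_sonic_solution \<gamma> l f f' g \<phi> v C"
  obtains \<sigma> where "\<bar>\<sigma>\<bar> = c_star \<gamma>" "\<And>y. y \<in> {0<..<f 0} \<Longrightarrow> v (0, y) = (\<sigma>, 0)"
proof -
  let ?I = "{0<..<f 0}"
  have \<phi>: "C11_closure \<Omega> \<phi> v" using s by (simp add: subsonic_sonic_solution_def)
  have v2: "snd (v (0, y)) = 0" if "y \<in> ?I" for y
    by (rule throat_tangential[OF \<phi> _ that]) (use s in \<open>auto simp: subsonic_sonic_solution_def\<close>)
  have v1: "\<bar>fst (v (0, y))\<bar> = c_star \<gamma>" if "y \<in> ?I" for y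
  proof -
    have "norm (v (0, y)) = c_star \<gamma>" using s that by (auto simp: subsonic_sonic_solution_def)
    then show ?thesis using v2[OF that] by (simp add: norm_prod_def)
  qed
  obtain L where L: "L-lipschitz_on (closure \<Omega>) v" using \<phi> by (auto simp: C11_closure_def)
  have "continuous_on ?I (\<lambda>y. v (0, y))"
    by (rule continuous_on_compose2[OF lipschitz_on_continuous_on[OF L]])
      (use throat_in_closure in \<open>auto intro!: continuous_intros\<close>)
  then have "continuous_on ?I (\<lambda>y. fst (v (0, y)))" by (intro continuous_intros)
  moreover have "(\<lambda>y. fst (v (0, y))) ` ?I \<subseteq> {c_star \<gamma>, - c_star \<gamma>}"
    using v1 by (force simp: abs_if split: if_splits)
  then have "finite ((\<lambda>y. fst (v (0, y))) ` ?I)" by (rule finite_subset) simp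
  ultimately have "(\<lambda>y. fst (v (0, y))) constant_on ?I"
    by (intro continuous_finite_range_constant) auto
  then obtain \<sigma> where \<sigma>: "\<And>y. y \<in> ?I \<Longrightarrow> fst (v (0, y)) = \<sigma>" by (auto simp: constant_on_def)
  have "f 0 / 2 \<in> ?I" using f_pos[of 0] l_neg by simp
  then have "\<bar>\<sigma>\<bar> = c_star \<gamma>" using v1 \<sigma> by metis
  then show ?thesis using \<sigma> v2 by (intro that[of \<sigma>]) (auto simp: prod_eq_iff)
qed

text \<open>
  The energy argument. The test function is built from \<open>soft_threshold \<epsilon> \<psi>\<close>, where \<open>\<psi>\<close> is the
  difference of the potentials normalized to zero on the inlet. The result is that \<open>\<nabla>\<psi> = 0\<close>
  wherever \<open>\<psi> \<noteq> 0\<close>, that is \<open>\<nabla>(\<psi>\<^sup>2) = 0\<close>. Horizontal segments join every point of the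
  domain to the inlet inside the domain, since the wall descends, so \<open>\<psi>\<^sup>2\<close> is zero everywhere.
\<close>

lemma unique_of_equal_throat_velocity:
  assumes \<gamma>: "\<gamma> > 1"
    and s1: "subsonic_sonic_solution \<gamma> l f f' g \<phi>\<^sub>1 v\<^sub>1 C\<^sub>1"
    and s2: "subsonic_sonic_solution \<gamma> l f f' g \<phi>\<^sub>2 v\<^sub>2 C\<^sub>2"
    and eq: "\<And>y. y \<in> {0<..<f 0} \<Longrightarrow> v\<^sub>1 (0, y) = v\<^sub>2 (0, y)"
  shows "(\<forall>z\<in>closure \<Omega>. \<phi>\<^sub>1 z = \<phi>\<^sub>2 z) \<and> C\<^sub>1 = C\<^sub>2"
proof -
  obtain L\<^sub>1 where L\<^sub>1: "L\<^sub>1-lipschitz_on (closure \<Omega>) v\<^sub>1"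
    using s1 by (auto simp: subsonic_sonic_solution_def C11_closure_def)
  obtain L\<^sub>2 where L\<^sub>2: "L\<^sub>2-lipschitz_on (closure \<Omega>) v\<^sub>2"
    using s2 by (auto simp: subsonic_sonic_solution_def C11_closure_def)
  have vc: "continuous_on (closure \<Omega>) v\<^sub>1" "continuous_on (closure \<Omega>) v\<^sub>2"
    by (rule lipschitz_on_continuous_on[OF L\<^sub>1] lipschitz_on_continuous_on[OF L\<^sub>2])+
  have sub: "\<Omega> \<subseteq> closure \<Omega>" by (rule closure_subset)
  have n1: "norm (v\<^sub>1 z) \<le> c_star \<gamma>" if "z \<in> closure \<Omega>" for z
    by (rule continuous_on_closure_norm_le[OF vc(1) _ that])
      (use s1 in \<open>auto simp: subsonic_sonic_solution_def less_imp_le\<close>)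
  have n2: "norm (v\<^sub>2 z) \<le> c_star \<gamma>" if "z \<in> closure \<Omega>" for z
    by (rule continuous_on_closure_norm_le[OF vc(2) _ that])
      (use s2 in \<open>auto simp: subsonic_sonic_solution_def less_imp_le\<close>)

  define q\<^sub>1 q\<^sub>2 Q where "q\<^sub>1 z = mass_flux \<gamma> (v\<^sub>1 z)" and "q\<^sub>2 z = mass_flux \<gamma> (v\<^sub>2 z)"
    and "Q z = q\<^sub>1 z - q\<^sub>2 z" for z
  obtain Lm where Lm: "0 \<le> Lm" "\<And>a b :: real \<times> real. norm a \<le> c_star \<gamma> \<Longrightarrow> norm b \<le> c_star \<gamma> \<Longrightarrow>
     norm (mass_flux \<gamma> a - mass_flux \<gamma> b) \<le> Lm * norm (a - b)"
    using mass_flux_lipschitz[OF \<gamma>, where ?'a = "real \<times> real"] by blast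
  have ql1: "(Lm * L\<^sub>1)-lipschitz_on (closure \<Omega>) q\<^sub>1"
  proof (rule lipschitz_onI)
    fix z w assume zw: "z \<in> closure \<Omega>" "w \<in> closure \<Omega>"
    have "dist (q\<^sub>1 z) (q\<^sub>1 w) \<le> Lm * dist (v\<^sub>1 z) (v\<^sub>1 w)"
      using Lm(2)[OF n1 n1] zw by (simp add: q\<^sub>1_def dist_norm)
    also have "\<dots> \<le> Lm * (L\<^sub>1 * dist z w)"
      using lipschitz_onD[OF L\<^sub>1] zw Lm(1) by (intro mult_left_mono) auto
    finally show "dist (q\<^sub>1 z) (q\<^sub>1 w) \<le> Lm * L\<^sub>1 * dist z w" by (simp add: mult.assoc)
  qed (use Lm(1) lipschitz_on_nonneg[OF L\<^sub>1] in simp)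
  have ql2: "(Lm * L\<^sub>2)-lipschitz_on (closure \<Omega>) q\<^sub>2"
  proof (rule lipschitz_onI)
    fix z w assume zw: "z \<in> closure \<Omega>" "w \<in> closure \<Omega>"
    have "dist (q\<^sub>2 z) (q\<^sub>2 w) \<le> Lm * dist (v\<^sub>2 z) (v\<^sub>2 w)"
      using Lm(2)[OF n2 n2] zw by (simp add: q\<^sub>2_def dist_norm)
    also have "\<dots> \<le> Lm * (L\<^sub>2 * dist z w)"
      using lipschitz_onD[OF L\<^sub>2] zw Lm(1) by (intro mult_left_mono) auto
    finally show "dist (q\<^sub>2 z) (q\<^sub>2 w) \<le> Lm * L\<^sub>2 * dist z w" by (simp add: mult.assoc)
  qed (use Lm(1) lipschitz_on_nonneg[OF L\<^sub>2] in simp)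
  have qc: "continuous_on (closure \<Omega>) q\<^sub>1" "continuous_on (closure \<Omega>) q\<^sub>2"
    by (rule lipschitz_on_continuous_on[OF ql1] lipschitz_on_continuous_on[OF ql2])+
  have Ql: "(Lm * L\<^sub>1 + Lm * L\<^sub>2)-lipschitz_on (closure \<Omega>) Q"
    unfolding Q_def[abs_def] by (rule lipschitz_on_diff[OF ql1 ql2])
  have Qc: "continuous_on (closure \<Omega>) Q" by (rule lipschitz_on_continuous_on[OF Ql])
  have Qdiv: "weakly_div_free \<Omega> Q"
    unfolding Q_def[abs_def]
    by (rule weakly_div_free_diff[OF open_domain bounded_domain _ qc(1) _ qc(2)])
      (use s1 s2 in \<open>auto simp: subsonic_sonic_solution_def q\<^sub>1_def[abs_def] q\<^sub>2_def[abs_def] mass_flux_def\<close>)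
  have "\<exists>C. \<forall>z\<in>\<Omega>. \<bar>Q z \<bullet> weight_grad z\<bar> \<le> C * weight z"
  proof (rule weight_flux_bound[OF Ql])
    show "Q (0, y) = 0" if "y \<in> {0<..<f 0}" for y
      using eq[OF that] by (simp add: Q_def q\<^sub>1_def q\<^sub>2_def)
    show "snd (Q (x, 0)) = 0" if "x \<in> {g 0<..<0}" for x
      using s1 s2 that by (simp add: subsonic_sonic_solution_def Q_def q\<^sub>1_def q\<^sub>2_def mass_flux_def)
    show "snd (Q (x, f x)) - f' x * fst (Q (x, f x)) = 0" if "x \<in> {l<..<0}" for x
    proof -
      have "snd (v\<^sub>1 (x, f x)) = f' x * fst (v\<^sub>1 (x, f x))" "snd (v\<^sub>2 (x, f x)) = f' x * fst (v\<^sub>2 (x, f x))"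
        using s1 s2 that by (auto simp: subsonic_sonic_solution_def)
      then show ?thesis by (simp add: Q_def q\<^sub>1_def q\<^sub>2_def mass_flux_def algebra_simps)
    qed
  qed
  then obtain C where C: "\<And>z. z \<in> \<Omega> \<Longrightarrow> \<bar>Q z \<bullet> weight_grad z\<bar> \<le> C * weight z" by blast

  define \<psi> w where "\<psi> z = \<phi>\<^sub>1 z - \<phi>\<^sub>2 z - (C\<^sub>1 - C\<^sub>2)" and "w z = v\<^sub>1 z - v\<^sub>2 z" for z
  have \<psi>c: "continuous_on (closure \<Omega>) \<psi>"
    unfolding \<psi>_def[abs_def] using s1 s2
    by (intro continuous_intros) (auto simp: subsonic_sonic_solution_def C11_closure_def)
  have wc: "continuous_on (closure \<Omega>) w"
    unfolding w_def[abs_def] by (intro continuous_intros vc)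
  have \<psi>D: "GDERIV \<psi> z :> w z" if "z \<in> \<Omega>" for z
  proof -
    have "GDERIV \<phi>\<^sub>1 z :> v\<^sub>1 z" "GDERIV \<phi>\<^sub>2 z :> v\<^sub>2 z"
      using s1 s2 that by (auto simp: subsonic_sonic_solution_def C11_closure_def)
    then show ?thesis
      unfolding \<psi>_def[abs_def] w_def using GDERIV_diff[OF GDERIV_diff GDERIV_const] by fastforce
  qed
  have \<psi>_inlet: "\<psi> (g y, y) = 0" if "y \<in> {0..f l}" for y
  proof (rule zero_on_closed_interval[OF fl_pos _ _ that])
    obtain g' where "C1_on_interval 0 (f l) g g'" using inlet by (auto simp: inlet_curve_def)
    then have "continuous_on {0..f l} g" by (rule C1_on_interval_continuous)
    then show "continuous_on {0..f l} (\<lambda>y. \<psi> (g y, y))"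
      using inlet_in_closure by (intro continuous_on_compose2[OF \<psi>c] continuous_intros) auto
    show "\<psi> (g y, y) = 0" if "y \<in> {0<..<f l}" for y
      using s1 s2 that by (auto simp: \<psi>_def subsonic_sonic_solution_def)
  qed
  have bnd: "\<exists>B. \<forall>z\<in>closure \<Omega>. norm (h z) \<le> B" if "continuous_on (closure \<Omega>) h"
    for h :: "real \<times> real \<Rightarrow> 'b::real_normed_vector"
    using compact_imp_bounded[OF compact_continuous_image[OF that compact_closure_domain]]
    by (auto simp: bounded_iff)

  have key: "w z = 0" if z: "z \<in> \<Omega>" and nz: "\<psi> z \<noteq> 0" for z
  proof -
    \<comment> \<open>Any threshold below \<open>\<bar>\<psi> z\<bar>\<close> works: the thresholding must increase strictly at \<open>\<psi> z\<close>.\<close>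
    define \<epsilon> where "\<epsilon> = \<bar>\<psi> z\<bar> / 2"
    have \<epsilon>: "0 < \<epsilon>" using nz by (simp add: \<epsilon>_def)
    define u u' where "u z = soft_threshold \<epsilon> (\<psi> z)" and "u' z = soft_threshold_deriv \<epsilon> (\<psi> z) *\<^sub>R w z" for z
    have T': "0 \<le> soft_threshold_deriv \<epsilon> t" for t by (simp add: soft_threshold_deriv_def)
    have uc: "continuous_on (closure \<Omega>) u"
      unfolding u_def[abs_def]
      by (rule continuous_on_compose2[OF _ \<psi>c subset_UNIV])
        (blast intro: continuous_at_imp_continuous_on DERIV_isCont soft_threshold_has_derivative)
    have u'c: "continuous_on (closure \<Omega>) u'"
      unfolding u'_def[abs_def]
      by (intro continuous_intros wc continuous_on_compose2[OF continuous_on_soft_threshold_deriv \<psi>c subset_UNIV])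
    obtain B where B: "\<And>z. z \<in> closure \<Omega> \<Longrightarrow> norm (Q z) \<le> B" using bnd[OF Qc] by blast
    obtain Bu where Bu: "\<And>z. z \<in> closure \<Omega> \<Longrightarrow> norm (u z) \<le> Bu" using bnd[OF uc] by blast
    obtain Bu' where Bu': "\<And>z. z \<in> closure \<Omega> \<Longrightarrow> norm (u' z) \<le> Bu'" using bnd[OF u'c] by blast
    have int: "(LINT z:\<Omega>|lborel. Q z \<bullet> u' z) = 0"
    proof (rule weakly_div_free_integral_gradient[where D = weight and D' = weight_grad and u = u
          and B = B and C = C and Bu = Bu and Bu' = Bu'])
      show "GDERIV u z :> u' z" if "z \<in> \<Omega>" for z
        unfolding u_def[abs_def] u'_def
        by (rule GDERIV_DERIV_compose[OF \<psi>D[OF that] soft_threshold_has_derivative])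
      fix \<delta> :: real assume \<delta>: "0 < \<delta>"
      let ?K = "{z \<in> closure \<Omega>. \<epsilon> \<le> \<bar>\<psi> z\<bar> \<and> \<delta> \<le> weight z}"
      have "closed {z \<in> closure \<Omega>. \<epsilon> \<le> \<bar>\<psi> z\<bar>}" "closed {z \<in> closure \<Omega>. \<delta> \<le> weight z}"
        by (intro continuous_on_closed_Collect_le continuous_intros \<psi>c continuous_weight closed_closure)+
      then have "compact (closure \<Omega> \<inter> ({z \<in> closure \<Omega>. \<epsilon> \<le> \<bar>\<psi> z\<bar>} \<inter> {z \<in> closure \<Omega>. \<delta> \<le> weight z}))"
        by (intro compact_Int_closed compact_closure_domain closed_Int)
      moreover have "closure \<Omega> \<inter> ({z \<in> closure \<Omega>. \<epsilon> \<le> \<bar>\<psi> z\<bar>} \<inter> {z \<in> closure \<Omega>. \<delta> \<le> weight z}) = ?K" by auto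
      ultimately have "compact ?K" by simp
      moreover have "?K \<subseteq> \<Omega>"
      proof
        fix z assume z: "z \<in> ?K"
        have "snd z \<in> {0..f l}" using closure_domain[of "fst z" "snd z"] z by auto
        then have "fst z \<noteq> g (snd z)" using \<psi>_inlet[of "snd z"] z \<epsilon> by (cases z) auto
        then show "z \<in> \<Omega>" using z \<delta> by (intro closure_off_boundary) auto
      qed
      moreover have "u z = 0" if "z \<in> \<Omega> - ?K" "\<delta> < weight z" for z
        using that sub by (auto simp: u_def soft_threshold_def not_le)
      ultimately show "\<exists>K. compact K \<and> K \<subseteq> \<Omega> \<and> (\<forall>z\<in>\<Omega> - K. \<delta> < weight z \<longrightarrow> u z = 0)"
        by (intro exI[of _ ?K]) blast
    qed (use open_domain bounded_domain Qdiv sub B Bu Bu' C weight_GDERIV weight_pos continuous_weight_grad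
        continuous_on_subset[OF Qc sub] continuous_on_subset[OF u'c sub] in auto)
    have mono: "0 \<le> Q z \<bullet> w z" if "z \<in> \<Omega>" for z
      using mass_flux_monotone(1)[OF \<gamma> n1 n2, of z z] that sub by (auto simp: Q_def q\<^sub>1_def q\<^sub>2_def w_def)
    have "Q z \<bullet> u' z = 0"
    proof (rule set_integral_nonneg_eq_0_open[OF open_domain bounded_domain _ _ _ int z])
      show "continuous_on \<Omega> (\<lambda>z. Q z \<bullet> u' z)"
        by (intro continuous_intros continuous_on_subset[OF Qc sub] continuous_on_subset[OF u'c sub])
      show "0 \<le> Q z \<bullet> u' z" if "z \<in> \<Omega>" for z using mono[OF that] T' by (simp add: u'_def)
      show "Q z \<bullet> u' z \<le> B * Bu'" if "z \<in> \<Omega>" for z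
        using norm_cauchy_schwarz[of "Q z" "u' z"] mult_mono[OF B Bu', of z z] that sub norm_ge_zero[of "Q z"]
          order_trans[OF norm_ge_zero B[of z]] by fastforce
    qed
    moreover have "0 < soft_threshold_deriv \<epsilon> (\<psi> z)"
      using nz by (auto simp: soft_threshold_deriv_def \<epsilon>_def max_def abs_if split: if_splits)
    ultimately have "Q z \<bullet> w z = 0" by (simp add: u'_def)
    then show ?thesis
      using mass_flux_monotone(2)[OF \<gamma> n1 n2, of z z] z sub by (auto simp: Q_def q\<^sub>1_def q\<^sub>2_def w_def)
  qed

  have \<psi>0: "\<psi> z = 0" if z: "z \<in> \<Omega>" for z
  proof -
    obtain x y where xy: "z = (x, y)" by (cases z)
    have m: "x < 0" "0 < y" "y < f l" "g y < x" "y < wall_ext x"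
      using z by (auto simp: xy mem_domain inlet_ext_eq)
    have line: "(s, y) \<in> \<Omega>" if s: "g y < s" "s \<le> x" for s
    proof -
      have "y < wall_ext s"
        using m s wall_ext_gt_left[of s] f_antimono[of s x] by (cases "s < l") (auto simp: wall_ext_eq)
      then show ?thesis using m s by (simp add: mem_domain inlet_ext_eq)
    qed
    have cl: "(s, y) \<in> closure \<Omega>" if "s \<in> {g y..x}" for s
      using that line[of s] sub inlet_in_closure m by (cases "s = g y") auto
    have "(\<psi> (x, y))\<^sup>2 = (\<psi> (g y, y))\<^sup>2"
    proof (rule DERIV_isconst_end[OF m(4)])
      show "continuous_on {g y..x} (\<lambda>s. (\<psi> (s, y))\<^sup>2)"
        using cl by (intro continuous_intros continuous_on_compose2[OF \<psi>c]) auto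
      fix s assume s: "g y < s" "s < x"
      have "((\<lambda>s. \<psi> (s, y)) has_real_derivative fst (w (s, y))) (at s)"
        by (rule GDERIV_imp_partials(1)[OF \<psi>D[OF line]]) (use s in auto)
      then have "((\<lambda>s. (\<psi> (s, y))\<^sup>2) has_real_derivative 2 * \<psi> (s, y) * fst (w (s, y))) (at s)"
        by (auto intro!: derivative_eq_intros)
      moreover have "\<psi> (s, y) * fst (w (s, y)) = 0" using key[OF line[of s]] s by force
      ultimately show "((\<lambda>s. (\<psi> (s, y))\<^sup>2) has_real_derivative 0) (at s)" by (simp add: mult.assoc)
    qed
    then show ?thesis using \<psi>_inlet[of y] m by (simp add: xy)
  qed
  have \<psi>cl: "\<psi> z = 0" if "z \<in> closure \<Omega>" for z
    using continuous_constant_on_closure[OF \<psi>c \<psi>0 that] by blast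
  have "f 0 / 2 \<in> {0<..<f 0}" using f_pos[of 0] l_neg by simp
  then have "\<psi> (0, f 0 / 2) = - (C\<^sub>1 - C\<^sub>2)" and "(0, f 0 / 2) \<in> closure \<Omega>"
    using s1 s2 throat_in_closure by (auto simp: subsonic_sonic_solution_def \<psi>_def image_subset_iff)
  then have "C\<^sub>1 = C\<^sub>2" using \<psi>cl by fastforce
  then show ?thesis using \<psi>cl by (auto simp: \<psi>_def)
qed

end

theorem theorem3p2:
  fixes \<gamma> l :: real and f f' g :: "real \<Rightarrow> real"
    and \<phi>\<^sub>1 \<phi>\<^sub>2 :: "real \<times> real \<Rightarrow> real" and v\<^sub>1 v\<^sub>2 :: "real \<times> real \<Rightarrow> real \<times> real"
    and C\<^sub>1 C\<^sub>2 :: real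
  assumes "\<gamma> > 1"
    and "convergent_wall l f f'"
    and "inlet_curve l f g"
    and "subsonic_sonic_solution \<gamma> l f f' g \<phi>\<^sub>1 v\<^sub>1 C\<^sub>1"
    and "subsonic_sonic_solution \<gamma> l f f' g \<phi>\<^sub>2 v\<^sub>2 C\<^sub>2"
  shows "(exits_through_throat f v\<^sub>1 \<and> exits_through_throat f v\<^sub>2 \<longrightarrow>
            (\<forall>z\<in>closure (nozzle_domain l f g). \<phi>\<^sub>1 z = \<phi>\<^sub>2 z) \<and> C\<^sub>1 = C\<^sub>2) \<and>
         (((\<forall>z\<in>closure (nozzle_domain l f g). \<phi>\<^sub>1 z = \<phi>\<^sub>2 z) \<and> C\<^sub>1 = C\<^sub>2) \<or>
          ((\<forall>z\<in>closure (nozzle_domain l f g). \<phi>\<^sub>1 z = - \<phi>\<^sub>2 z) \<and> C\<^sub>1 = - C\<^sub>2))"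
proof -
  interpret nozzle l f f' g by unfold_locales (rule assms(2,3))+
  obtain \<sigma>\<^sub>1 where \<sigma>\<^sub>1: "\<bar>\<sigma>\<^sub>1\<bar> = c_star \<gamma>" "\<And>y. y \<in> {0<..<f 0} \<Longrightarrow> v\<^sub>1 (0, y) = (\<sigma>\<^sub>1, 0)"
    using throat_velocity[OF assms(4)] by blast
  obtain \<sigma>\<^sub>2 where \<sigma>\<^sub>2: "\<bar>\<sigma>\<^sub>2\<bar> = c_star \<gamma>" "\<And>y. y \<in> {0<..<f 0} \<Longrightarrow> v\<^sub>2 (0, y) = (\<sigma>\<^sub>2, 0)"
    using throat_velocity[OF assms(5)] by blast
  have "f 0 / 2 \<in> {0<..<f 0}" using f_pos[of 0] l_neg by simp
  then have out: "0 < \<sigma>" if "exits_through_throat f v" "\<And>y. y \<in> {0<..<f 0} \<Longrightarrow> v (0, y) = (\<sigma>, 0)"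
    for v \<sigma>
    using that unfolding exits_through_throat_def by (metis fst_conv)
  have same: "(\<forall>z\<in>closure \<Omega>. \<phi>\<^sub>1 z = \<phi>\<^sub>2 z) \<and> C\<^sub>1 = C\<^sub>2" if "\<sigma>\<^sub>1 = \<sigma>\<^sub>2"
    by (rule unique_of_equal_throat_velocity[OF assms(1,4,5)]) (simp add: \<sigma>\<^sub>1 \<sigma>\<^sub>2 that)
  have opposite: "(\<forall>z\<in>closure \<Omega>. \<phi>\<^sub>1 z = - \<phi>\<^sub>2 z) \<and> C\<^sub>1 = - C\<^sub>2" if "\<sigma>\<^sub>1 = - \<sigma>\<^sub>2"
    by (rule unique_of_equal_throat_velocity[OF assms(1,4) subsonic_sonic_solution_reverse[OF assms(5)]])
      (simp add: \<sigma>\<^sub>1 \<sigma>\<^sub>2 that)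
  have "\<sigma>\<^sub>1 = \<sigma>\<^sub>2 \<or> \<sigma>\<^sub>1 = - \<sigma>\<^sub>2" using \<sigma>\<^sub>1(1) \<sigma>\<^sub>2(1) by (auto simp: abs_if split: if_splits)
  moreover have "\<sigma>\<^sub>1 = \<sigma>\<^sub>2" if "exits_through_throat f v\<^sub>1" "exits_through_throat f v\<^sub>2"
    using out[OF that(1) \<sigma>\<^sub>1(2)] out[OF that(2) \<sigma>\<^sub>2(2)] \<sigma>\<^sub>1(1) \<sigma>\<^sub>2(1) by simp
  ultimately show ?thesis using same opposite by blast
qed

end
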